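(* Let $\beta>1$ be a non-integer and $p\in(0,1)$. The measures $\nu_\beta$ and $m_p\otimes\lambda$ on $\Omega\times J_\beta$ are mutually singular.
   Context: Let $J_\beta=[0,\lfloor\beta\rfloor/(\beta-1)]$ with Borel $\sigma$-algebra $\mathcal B$, and let $\lambda$ be the normalized Lebesgue measure on $J_\beta$. Switch regions: $S_k=\left[\frac{k}{\beta},\frac{\lfloor\beta\rfloor}{\beta(\beta-1)}+\frac{k-1}{\beta}\right]$, $k=1,\ldots,\lfloor\beta\rfloor$; $S=\bigcup_{k}S_k$. Equality regions: $E_0=[0,\frac1\beta)$, $E_k=\left(\frac{\lfloor\beta\rfloor}{\beta(\beta-1)}+\frac{k-1}{\beta},\frac{k+1}{\beta}\right)$ for $1\le k\le\lfloor\beta\rfloor-1$, and $E_{\lfloor\beta\rfloor}=\left(\frac{\lfloor\beta\rfloor}{\beta(\beta-1)}+\frac{\lfloor\beta\rfloor-1}{\beta},\frac{\lfloor\beta\rfloor}{\beta-1}\right]$. Let $\Omega=\{0,1\}^{\mathbb N}$ with product $\sigma$-algebra $\mathcal A$ and left shift $\sigma$. Define $d_1(\omega,x)=k$ if $x\in E_k$, or if $x\in S_k$ and $\omega_1=1$; $d_1(\omega,x)=k-1$ if $x\in S_k$ and $\omega_1=0$. The map $K_\beta:\Omega\times J_\beta\to\Omega\times J_\beta$ is $K_\beta(\omega,x)=(\omega,\beta x-d_1(\omega,x))$ if $x\notin S$ and $K_\beta(\omega,x)=(\sigma(\omega),\beta x-d_1(\omega,x))$ if $x\in S$. Put $d_n(\omega,x)=d_1(K_\beta^{n-1}(\omega,x))$.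 $m_p$ is the Bernoulli measure on $\Omega$: $m_p(\{\omega_1=i_1,\ldots,\omega_n=i_n\})=p^{\sum_j i_j}(1-p)^{n-\sum_j i_j}$. Let $D=\{0,1,\ldots,\lfloor\beta\rfloor\}^{\mathbb N}$ with product $\sigma$-algebra and uniform product measure $\mathbb P$ (each digit i.i.d. uniform). Let $\varphi(\omega,x)=(d_1(\omega,x),d_2(\omega,x),\ldots)\in D$ and $Z=\{(\omega,x):K_\beta^n(\omega,x)\in\Omega\times S\text{ for infinitely many }n\ge0\}$. The restriction of $\varphi$ to $Z$ is a bimeasurable bijection onto its image. The measure $\nu_\beta$ on $\mathcal A\otimes\mathcal B$ is $\nu_\beta(A)=\mathbb P(\varphi(Z\cap A))$; it is known to be the unique $K_\beta$-invariant probability measure of maximal entropy, the entropy being $\log(1+\lfloor\beta\rfloor)$. *)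

theory Defs
  imports "HOL-Probability.Probability"
begin

section \<open>Mutual singularity\<close>

definition mutually_singular :: "'a measure \<Rightarrow> 'a measure \<Rightarrow> bool" where
  "mutually_singular M N \<longleftrightarrow> sets M = sets N \<and>
     (\<exists>A\<in>sets M. emeasure M A = 0 \<and> emeasure N (space N - A) = 0)"

section \<open>The random beta-transformation\<close>

definition maxdigit :: "real \<Rightarrow> nat" where
  "maxdigit \<beta> = nat \<lfloor>\<beta>\<rfloor>"

definition J_beta :: "real \<Rightarrow> real set" where
  "J_beta \<beta> = {0 .. real (maxdigit \<beta>) / (\<beta> - 1)}"

text \<open>Only the indices \<open>1 \<le> k \<le> maxdigit \<beta>\<close> are switch regions.\<close>

definition switch :: "real \<Rightarrow> nat \<Rightarrow> real set" where
  "switch \<beta> k = {real k / \<beta> .. real (maxdigit \<beta>) / (\<beta> * (\<beta> - 1)) + (real k - 1) / \<beta>}"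

definition switch_region :: "real \<Rightarrow> real set" where
  "switch_region \<beta> = (\<Union>k\<in>{1..maxdigit \<beta>}. switch \<beta> k)"

text \<open>Only the indices \<open>0 \<le> k \<le> maxdigit \<beta>\<close> are equality regions.\<close>

definition equality :: "real \<Rightarrow> nat \<Rightarrow> real set" where
  "equality \<beta> k =
    (if k = 0 then {0 ..< 1 / \<beta>}
     else if k = maxdigit \<beta> then
       {real (maxdigit \<beta>) / (\<beta> * (\<beta> - 1)) + (real (maxdigit \<beta>) - 1) / \<beta>
          <.. real (maxdigit \<beta>) / (\<beta> - 1)}
     else
       {real (maxdigit \<beta>) / (\<beta> * (\<beta> - 1)) + (real k - 1) / \<beta> <..< (real k + 1) / \<beta>})"

text \<open>
  Coin sequences are functions \<open>nat \<Rightarrow> bool\<close>, with \<open>True\<close> for 1 and \<open>False\<close> for 0, and all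
  sequences start at index 0 (so \<open>\<omega> 0\<close> is the first coin).  For \<open>x \<in> J_beta \<beta>\<close> with \<open>\<beta> > 1\<close>
  not an integer, exactly one region contains \<open>x\<close>.
\<close>

definition d1 :: "real \<Rightarrow> (nat \<Rightarrow> bool) \<times> real \<Rightarrow> nat" where
  "d1 \<beta> = (\<lambda>(\<omega>, x).
     if x \<in> switch_region \<beta> then
       (let k = (THE k. k \<in> {1..maxdigit \<beta>} \<and> x \<in> switch \<beta> k)
        in if \<omega> 0 then k else k - 1)
     else (THE k. k \<in> {0..maxdigit \<beta>} \<and> x \<in> equality \<beta> k))"

definition shift :: "(nat \<Rightarrow> 'a) \<Rightarrow> nat \<Rightarrow> 'a" where
  "shift \<omega> = (\<lambda>i. \<omega> (Suc i))"

definition K_beta :: "real \<Rightarrow> (nat \<Rightarrow> bool) \<times> real \<Rightarrow> (nat \<Rightarrow> bool) \<times> real" where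
  "K_beta \<beta> = (\<lambda>(\<omega>, x).
     (if x \<in> switch_region \<beta> then shift \<omega> else \<omega>, \<beta> * x - real (d1 \<beta> (\<omega>, x))))"

definition digits :: "real \<Rightarrow> (nat \<Rightarrow> bool) \<times> real \<Rightarrow> nat \<Rightarrow> nat" where
  "digits \<beta> z = (\<lambda>n. d1 \<beta> ((K_beta \<beta> ^^ n) z))"

definition Z_beta :: "real \<Rightarrow> ((nat \<Rightarrow> bool) \<times> real) set" where
  "Z_beta \<beta> = {z \<in> UNIV \<times> J_beta \<beta>. \<exists>\<^sub>\<infinity>n. (K_beta \<beta> ^^ n) z \<in> UNIV \<times> switch_region \<beta>}"

section \<open>The measures\<close>

definition coin_measure :: "real \<Rightarrow> (nat \<Rightarrow> bool) measure" where
  "coin_measure p = (\<Pi>\<^sub>M i\<in>UNIV. measure_pmf (bernoulli_pmf p))"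

definition normalized_lebesgue :: "real \<Rightarrow> real measure" where
  "normalized_lebesgue \<beta> = uniform_measure (restrict_space lborel (J_beta \<beta>)) (J_beta \<beta>)"

definition digit_measure :: "real \<Rightarrow> (nat \<Rightarrow> nat) measure" where
  "digit_measure \<beta> = (\<Pi>\<^sub>M i\<in>UNIV. uniform_count_measure {0..maxdigit \<beta>})"

definition phase_space :: "real \<Rightarrow> ((nat \<Rightarrow> bool) \<times> real) measure" where
  "phase_space \<beta> =
     (\<Pi>\<^sub>M i\<in>UNIV. count_space UNIV) \<Otimes>\<^sub>M restrict_space borel (J_beta \<beta>)"

definition nu :: "real \<Rightarrow> ((nat \<Rightarrow> bool) \<times> real) measure" where
  "nu \<beta> = measure_of (space (phase_space \<beta>)) (sets (phase_space \<beta>))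
     (\<lambda>A. emeasure (digit_measure \<beta>) (digits \<beta> ` (Z_beta \<beta> \<inter> A)))"

section \<open>The set function defining \<open>nu\<close> is a measure\<close>

definition val :: "real \<Rightarrow> (nat \<Rightarrow> nat) \<Rightarrow> real" where
  "val \<beta> d = (\<Sum>i. real (d i) / \<beta> ^ Suc i)"

definition visits :: "real \<Rightarrow> (nat \<Rightarrow> nat) \<Rightarrow> nat \<Rightarrow> bool" where
  "visits \<beta> d m \<longleftrightarrow> val \<beta> (\<lambda>i. d (i + m)) \<in> switch_region \<beta>"

definition visit_count :: "real \<Rightarrow> (nat \<Rightarrow> nat) \<Rightarrow> nat \<Rightarrow> nat" where
  "visit_count \<beta> d m = (\<Sum>l<m. if visits \<beta> d l then 1 else 0)"

definition coin_at :: "real \<Rightarrow> (nat \<Rightarrow> nat) \<Rightarrow> nat \<Rightarrow> bool" where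
  "coin_at \<beta> d m \<longleftrightarrow> 1 \<le> d m \<and> val \<beta> (\<lambda>i. d (i + m)) \<in> switch \<beta> (d m)"

text \<open>The inverse of the digit map: the coins are read off at the successive visits.\<close>

definition undigits :: "real \<Rightarrow> (nat \<Rightarrow> nat) \<Rightarrow> (nat \<Rightarrow> bool) \<times> real" where
  "undigits \<beta> d =
     (\<lambda>i. \<exists>m. visits \<beta> d m \<and> visit_count \<beta> d m = i \<and> coin_at \<beta> d m, val \<beta> d)"

lemma summable_digits:
  fixes \<beta> :: real
  assumes "\<beta> > 1" "\<And>i. d i \<le> n"
  shows "summable (\<lambda>i. real (d i) / \<beta> ^ Suc i)"
proof (rule summable_comparison_test')
  show "summable (\<lambda>i. real n * (1 / \<beta>) ^ Suc i)"
    using assms by (subst summable_Suc_iff) (intro summable_mult summable_geometric, auto)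
  show "norm (real (d i) / \<beta> ^ Suc i) \<le> real n * (1 / \<beta>) ^ Suc i" if "i \<ge> 0" for i
    using assms by (auto simp: power_divide divide_simps)
qed

context
  fixes \<beta> :: real
  assumes gt1: "\<beta> > 1" and nonint: "\<beta> \<notin> \<int>"
begin

private definition "n = maxdigit \<beta>"
private definition "U = real n / (\<beta> - 1)"

private lemma n_bounds: "1 \<le> n" "real n < \<beta>" "\<beta> < real n + 1"
proof -
  have 1: "\<lfloor>\<beta>\<rfloor> \<ge> 1" using gt1 by linarith
  then have 2: "real n = of_int \<lfloor>\<beta>\<rfloor>" by (simp add: n_def maxdigit_def)
  have "of_int \<lfloor>\<beta>\<rfloor> \<noteq> \<beta>" using nonint by (metis Ints_of_int)
  moreover have "of_int \<lfloor>\<beta>\<rfloor> \<le> \<beta>" "\<beta> < of_int \<lfloor>\<beta>\<rfloor> + 1" by linarith+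
  ultimately show "real n < \<beta>" "\<beta> < real n + 1" using 2 by linarith+
  show "1 \<le> n" using 1 2 by linarith
qed

private lemma U_eq: "\<beta> * U = U + real n"
  using gt1 by (simp add: U_def field_simps)

private lemma U_gt1: "U > 1"
  using gt1 n_bounds by (simp add: U_def)

private lemma U_lt2: "n \<ge> 2 \<Longrightarrow> U < 2"
  using gt1 n_bounds by (simp add: U_def field_simps)

private lemma J_iff: "x \<in> J_beta \<beta> \<longleftrightarrow> 0 \<le> x \<and> x \<le> U"
  by (simp add: J_beta_def U_def n_def)

private lemma upper_eq:
  "real (maxdigit \<beta>) / (\<beta> * (\<beta> - 1)) + (real k - 1) / \<beta> = (U + real k - 1) / \<beta>"
  using gt1 by (simp add: U_def n_def field_simps)

private lemma switch_iff: "x \<in> switch \<beta> k \<longleftrightarrow> real k \<le> \<beta> * x \<and> \<beta> * x \<le> U + real k - 1"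
  unfolding switch_def upper_eq using gt1 by (auto simp: field_simps)

private lemma switch_region_iff: "x \<in> switch_region \<beta> \<longleftrightarrow> (\<exists>k\<in>{1..n}. x \<in> switch \<beta> k)"
  by (auto simp: switch_region_def n_def)

private lemma equality_iff:
  "x \<in> equality \<beta> k \<longleftrightarrow>
    (if k = 0 then 0 \<le> \<beta> * x \<and> \<beta> * x < 1
     else if k = n then U + real n - 1 < \<beta> * x \<and> \<beta> * x \<le> U + real n
     else U + real k - 1 < \<beta> * x \<and> \<beta> * x < real k + 1)"
proof -
  have "x \<le> real n / (\<beta> - 1) \<longleftrightarrow> \<beta> * x \<le> U + real n"
    using gt1 unfolding U_eq[symmetric] U_def[symmetric] by simp
  then show ?thesis
    unfolding equality_def upper_eq unfolding n_def[symmetric]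
    using gt1 by (auto simp: field_simps zero_le_mult_iff)
qed

private lemma switch_unique:
  assumes "x \<in> switch \<beta> k" "k \<in> {1..n}" "x \<in> switch \<beta> k'" "k' \<in> {1..n}"
  shows "k = k'"
proof -
  have False if "x \<in> switch \<beta> k" "k \<in> {1..n}" "x \<in> switch \<beta> k'" "k' \<in> {1..n}" "k < k'" for k k'
  proof -
    have "n \<ge> 2" "real k + 1 \<le> real k'" using that by auto
    then show False using U_lt2 that by (auto simp: switch_iff)
  qed
  then show ?thesis using assms by (metis linorder_neqE_nat)
qed

private lemma d1_char:
  assumes x: "x \<in> J_beta \<beta>" and j: "j \<le> n" "\<beta> * x - real j \<in> J_beta \<beta>"
  shows "d1 \<beta> (\<omega>, x) = j \<longleftrightarrow> (x \<in> switch_region \<beta> \<longrightarrow> (\<omega> 0 \<longleftrightarrow> 1 \<le> j \<and> x \<in> switch \<beta> j))"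
proof -
  have jy: "real j \<le> \<beta> * x" "\<beta> * x \<le> U + real j" using j by (auto simp: J_iff)
  show ?thesis
  proof (cases "x \<in> switch_region \<beta>")
    case True
    then obtain k where k: "k \<in> {1..n}" "x \<in> switch \<beta> k" by (auto simp: switch_region_iff)
    have the: "(THE k. k \<in> {1..maxdigit \<beta>} \<and> x \<in> switch \<beta> k) = k"
      using k switch_unique by (intro the_equality) (auto simp: n_def)
    have ky: "real k \<le> \<beta> * x" "\<beta> * x \<le> U + real k - 1" using k by (auto simp: switch_iff)
    have "\<not> j \<ge> k + 1"
    proof
      assume "j \<ge> k + 1"
      then have "n \<ge> 2" "real j \<ge> real k + 1" using k j by auto
      then show False using U_lt2 jy ky by auto
    qed
    moreover have "\<not> j + 2 \<le> k"
    proof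
      assume "j + 2 \<le> k"
      then have "n \<ge> 2" "real j + 2 \<le> real k" using k j by auto
      then show False using U_lt2 jy ky by auto
    qed
    ultimately have "j = k \<or> j = k - 1 \<and> j \<noteq> k" by linarith
    moreover have "1 \<le> j \<and> x \<in> switch \<beta> j \<longleftrightarrow> j = k"
      using k j switch_unique[of x j k] by auto
    moreover have "d1 \<beta> (\<omega>, x) = (if \<omega> 0 then k else k - 1)"
      unfolding d1_def prod.case the Let_def using True by (simp only: if_True)
    moreover have "k - 1 \<noteq> k" using k by auto
    ultimately show ?thesis using True k by (auto split: if_splits)
  next
    case False
    have gap: "\<not> (real k + 1 \<le> \<beta> * x \<and> \<beta> * x \<le> U + real k)" if "k + 1 \<le> n" for k
      using False that by (force simp: switch_region_iff switch_iff)
    have uniq: "k = j" if "k \<le> n" "real k \<le> \<beta> * x" "\<beta> * x \<le> U + real k" for k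
    proof -
      have "\<not> k < j" using gap[of k] that j jy by linarith
      moreover have "\<not> j < k" using gap[of j] that j jy by linarith
      ultimately show ?thesis by simp
    qed
    have "(THE k. k \<in> {0..maxdigit \<beta>} \<and> x \<in> equality \<beta> k) = j"
    proof (rule the_equality)
      have 1: "U + real j - 1 < \<beta> * x" if "j \<noteq> 0"
        using gap[of "j - 1"] jy j that by (simp add: of_nat_diff)
      have 2: "\<beta> * x < real j + 1" if "j \<noteq> n"
        using gap[of j] jy j that by linarith
      show "j \<in> {0..maxdigit \<beta>} \<and> x \<in> equality \<beta> j"
        using 1 2 j jy n_bounds by (auto simp: equality_iff n_def[symmetric])
    next
      fix k assume "k \<in> {0..maxdigit \<beta>} \<and> x \<in> equality \<beta> k"
      then have "k \<le> n" "x \<in> equality \<beta> k" by (auto simp: n_def)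
      moreover from this have "real k \<le> \<beta> * x \<and> \<beta> * x \<le> U + real k"
        using U_gt1 by (auto simp: equality_iff split: if_splits)
      ultimately show "k = j" using uniq by auto
    qed
    then show ?thesis using False by (simp add: d1_def)
  qed
qed

private lemma d1_admissible:
  assumes x: "x \<in> J_beta \<beta>"
  shows "d1 \<beta> (\<omega>, x) \<le> n \<and> \<beta> * x - real (d1 \<beta> (\<omega>, x)) \<in> J_beta \<beta>"
proof (cases "x \<in> switch_region \<beta>")
  case True
  then obtain k where k: "k \<in> {1..n}" "x \<in> switch \<beta> k" by (auto simp: switch_region_iff)
  have kk: "\<beta> * x - real k \<in> J_beta \<beta>" "\<beta> * x - real (k - 1) \<in> J_beta \<beta>"
    using k by (auto simp: J_iff switch_iff of_nat_diff)
  show ?thesis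
  proof (cases "\<omega> 0")
    case True
    then have "d1 \<beta> (\<omega>, x) = k" using k kk by (subst d1_char[OF x]) auto
    then show ?thesis using k kk by auto
  next
    case False
    have "x \<notin> switch \<beta> (k - 1)" if "1 \<le> k - 1"
      using switch_unique[of x "k - 1" k] that k by fastforce
    then have "d1 \<beta> (\<omega>, x) = k - 1" using False k kk by (subst d1_char[OF x]) auto
    then show ?thesis using k kk by auto
  qed
next
  case False
  have y: "0 \<le> \<beta> * x" "\<beta> * x \<le> U + real n"
    using x gt1 by (auto simp: J_iff U_eq[symmetric])
  define j where "j = min n (nat \<lfloor>\<beta> * x\<rfloor>)"
  have "j \<le> n" by (simp add: j_def)
  moreover have "\<beta> * x - real j \<in> J_beta \<beta>"
    using y U_gt1 unfolding J_iff j_def min_def by (auto simp: of_nat_nat) linarith+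
  ultimately have "d1 \<beta> (\<omega>, x) = j" using False by (subst d1_char[OF x]) auto
  then show ?thesis using \<open>j \<le> n\<close> \<open>\<beta> * x - real j \<in> J_beta \<beta>\<close> by simp
qed

private lemma val_step:
  assumes "\<And>i. d i \<le> n"
  shows "\<beta> * val \<beta> d - real (d 0) = val \<beta> (\<lambda>i. d (Suc i))"
proof -
  have "summable (\<lambda>i. real (d i) / \<beta> ^ Suc i)" using summable_digits[OF gt1 assms] .
  then have "val \<beta> d = (\<Sum>i. real (d (Suc i)) / \<beta> ^ Suc (Suc i)) + real (d 0) / \<beta>"
    unfolding val_def by (subst suminf_split_head) auto
  moreover have "(\<Sum>i. real (d (Suc i)) / \<beta> ^ Suc (Suc i)) = val \<beta> (\<lambda>i. d (Suc i)) / \<beta>"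
    unfolding val_def using suminf_divide[OF summable_digits[OF gt1, of "\<lambda>i. d (Suc i)" n], of \<beta>] assms
    by (simp add: mult_ac)
  ultimately show ?thesis using gt1 by (simp add: field_simps)
qed

private lemma val_in_J:
  assumes "\<And>i. d i \<le> n"
  shows "val \<beta> d \<in> J_beta \<beta>"
proof -
  have s: "summable (\<lambda>i. real (d i) / \<beta> ^ Suc i)" using summable_digits[OF gt1 assms] .
  have "(\<lambda>i. (1 / \<beta>) ^ i) sums (1 / (1 - 1 / \<beta>))" using gt1 by (intro geometric_sums) auto
  then have "(\<lambda>i. real n / \<beta> * (1 / \<beta>) ^ i) sums (real n / \<beta> * (1 / (1 - 1 / \<beta>)))"
    by (rule sums_mult)
  also have "real n / \<beta> * (1 / (1 - 1 / \<beta>)) = U" using gt1 by (simp add: U_def field_simps)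
  finally have "(\<lambda>i. real n / \<beta> * (1 / \<beta>) ^ i) sums U" .
  then have "val \<beta> d \<le> U" unfolding val_def
    using gt1 assms by (intro sums_le[OF _ summable_sums[OF s]]) (auto simp: power_divide divide_simps)
  moreover have "0 \<le> val \<beta> d" unfolding val_def
    using gt1 s by (intro suminf_nonneg) auto
  ultimately show ?thesis by (simp add: J_iff)
qed

private lemma K_J: "x \<in> J_beta \<beta> \<Longrightarrow> snd (K_beta \<beta> (\<omega>, x)) \<in> J_beta \<beta>"
  using d1_admissible by (simp add: K_beta_def)

private lemma iter_J: "z \<in> UNIV \<times> J_beta \<beta> \<Longrightarrow> (K_beta \<beta> ^^ m) z \<in> UNIV \<times> J_beta \<beta>"
proof (induction m)
  case (Suc m)
  obtain \<omega> x where "(K_beta \<beta> ^^ m) z = (\<omega>, x)" by fastforce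
  with Suc K_J[of x \<omega>] show ?case by (simp add: mem_Times_iff)
qed simp

private lemma digits_le: "z \<in> UNIV \<times> J_beta \<beta> \<Longrightarrow> digits \<beta> z m \<le> n"
  using iter_J[of z m] d1_admissible[of "snd ((K_beta \<beta> ^^ m) z)" "fst ((K_beta \<beta> ^^ m) z)"]
  by (auto simp: digits_def mem_Times_iff)

private lemma val_digits:
  assumes "z \<in> UNIV \<times> J_beta \<beta>"
  shows "val \<beta> (digits \<beta> z) = snd z"
proof -
  define x where "x m = snd ((K_beta \<beta> ^^ m) z)" for m
  have step: "x (Suc m) = \<beta> * x m - real (digits \<beta> z m)" for m
    by (simp add: x_def K_beta_def digits_def split: prod.splits)
  have part: "(\<Sum>i<m. real (digits \<beta> z i) / \<beta> ^ Suc i) = x 0 - x m / \<beta> ^ m" for m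
  proof (induction m)
    case (Suc m)
    have "x (Suc m) / \<beta> ^ Suc m = x m / \<beta> ^ m - real (digits \<beta> z m) / \<beta> ^ Suc m"
      using gt1 by (simp add: step diff_divide_distrib)
    then show ?case using Suc by simp
  qed simp
  have xb: "0 \<le> x m" "x m \<le> U" for m
    using iter_J[OF assms, of m] by (auto simp: x_def mem_Times_iff J_iff)
  have "(\<lambda>m. U * (1 / \<beta>) ^ m) \<longlonglongrightarrow> U * 0"
    using gt1 by (intro tendsto_mult tendsto_const LIMSEQ_power_zero) auto
  then have "(\<lambda>m. x m / \<beta> ^ m) \<longlonglongrightarrow> 0"
    using xb gt1
    by (intro tendsto_sandwich[of "\<lambda>_. 0" "\<lambda>m. x m / \<beta> ^ m" sequentially "\<lambda>m. U * (1 / \<beta>) ^ m"])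
       (auto simp: power_divide divide_right_mono)
  then have "(\<lambda>m. x 0 - x m / \<beta> ^ m) \<longlonglongrightarrow> x 0 - 0" by (intro tendsto_diff tendsto_const)
  then have "(\<lambda>i. real (digits \<beta> z i) / \<beta> ^ Suc i) sums x 0"
    unfolding sums_def part by simp
  then show ?thesis by (simp add: val_def sums_iff x_def)
qed

private lemma digits_shift: "digits \<beta> ((K_beta \<beta> ^^ m) z) = (\<lambda>i. digits \<beta> z (i + m))"
  by (simp add: digits_def funpow_add)

private lemma snd_iter:
  assumes "z \<in> UNIV \<times> J_beta \<beta>"
  shows "snd ((K_beta \<beta> ^^ m) z) = val \<beta> (\<lambda>i. digits \<beta> z (i + m))"
  using val_digits[OF iter_J[OF assms, of m]] by (simp add: digits_shift)

private lemma fst_iter: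
  assumes "z \<in> UNIV \<times> J_beta \<beta>"
  shows "fst ((K_beta \<beta> ^^ m) z) = (\<lambda>i. fst z (i + visit_count \<beta> (digits \<beta> z) m))"
proof (induction m)
  case 0
  then show ?case by (simp add: visit_count_def)
next
  case (Suc m)
  show ?case
    using Suc snd_iter[OF assms, of m]
    by (auto simp: K_beta_def visit_count_def shift_def visits_def split: prod.splits)
qed

private lemma visits_iter:
  assumes "z \<in> UNIV \<times> J_beta \<beta>"
  shows "visits \<beta> (digits \<beta> z) m \<longleftrightarrow> (K_beta \<beta> ^^ m) z \<in> UNIV \<times> switch_region \<beta>"
  by (simp add: visits_def mem_Times_iff snd_iter[OF assms])

private lemma visit_count_hits:
  assumes "\<exists>\<^sub>\<infinity>m. visits \<beta> d m"
  shows "\<exists>m. visits \<beta> d m \<and> visit_count \<beta> d m = i"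
proof (induction i)
  case 0
  define m where "m = (LEAST m. visits \<beta> d m)"
  have "\<exists>m. visits \<beta> d m" using assms by (auto simp: INFM_nat)
  then have "visits \<beta> d m" "\<And>l. l < m \<Longrightarrow> \<not> visits \<beta> d l"
    unfolding m_def by (auto intro: LeastI dest: not_less_Least)
  then show ?case by (intro exI[of _ m]) (simp add: visit_count_def)
next
  case (Suc i)
  then obtain m0 where m0: "visits \<beta> d m0" "visit_count \<beta> d m0 = i" by auto
  define m where "m = (LEAST m. visits \<beta> d m \<and> m > m0)"
  have ex: "\<exists>m. visits \<beta> d m \<and> m > m0" using assms by (auto simp: INFM_nat)
  then have m: "visits \<beta> d m \<and> m > m0" unfolding m_def by (rule LeastI_ex)
  have no: "\<not> visits \<beta> d l" if "m0 < l" "l < m" for l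
    using not_less_Least[of l "\<lambda>m. visits \<beta> d m \<and> m > m0"] that by (auto simp: m_def)
  have "visit_count \<beta> d m = visit_count \<beta> d (Suc m0)"
    unfolding visit_count_def using m no by (intro sum.mono_neutral_right) auto
  then have "visit_count \<beta> d m = Suc i" using m0 by (simp add: visit_count_def)
  then show ?case using m by auto
qed

private lemma visit_count_inj:
  assumes "visits \<beta> d m" "visits \<beta> d m'" "visit_count \<beta> d m = visit_count \<beta> d m'"
  shows "m = m'"
proof -
  have "visit_count \<beta> d m < visit_count \<beta> d m'" if "visits \<beta> d m" "m < m'" for m m'
  proof -
    have "visit_count \<beta> d (Suc m) \<le> visit_count \<beta> d m'"
      unfolding visit_count_def using that by (intro sum_mono2) auto
    then show ?thesis using that by (simp add: visit_count_def)
  qed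
  then show ?thesis using assms by (metis linorder_neqE_nat less_irrefl)
qed

private lemma fst_undigits:
  assumes "visits \<beta> d m"
  shows "fst (undigits \<beta> d) (visit_count \<beta> d m) \<longleftrightarrow> coin_at \<beta> d m"
  using visit_count_inj assms by (auto simp: undigits_def)

private lemma undigits_digits:
  assumes "z \<in> Z_beta \<beta>"
  shows "undigits \<beta> (digits \<beta> z) = z"
proof -
  have z: "z \<in> UNIV \<times> J_beta \<beta>" using assms by (simp add: Z_beta_def)
  let ?d = "digits \<beta> z"
  have inf: "\<exists>\<^sub>\<infinity>m. visits \<beta> ?d m" using assms by (simp add: Z_beta_def visits_iter[OF z])
  have "fst (undigits \<beta> ?d) i \<longleftrightarrow> fst z i" for i
  proof -
    obtain m where m: "visits \<beta> ?d m" "visit_count \<beta> ?d m = i" using visit_count_hits[OF inf] by blast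
    obtain \<omega> x where K: "(K_beta \<beta> ^^ m) z = (\<omega>, x)" by fastforce
    have x: "x = val \<beta> (\<lambda>i. ?d (i + m))" using snd_iter[OF z, of m] K by simp
    have xJ: "x \<in> J_beta \<beta>" using iter_J[OF z, of m] K by simp
    have d: "?d m = d1 \<beta> (\<omega>, x)" by (simp add: digits_def K)
    have "\<omega> 0 \<longleftrightarrow> coin_at \<beta> ?d m"
      using d1_char[OF xJ, of "?d m" \<omega>] d1_admissible[OF xJ, of \<omega>] m(1) d
      by (simp add: coin_at_def visits_def x)
    moreover have "\<omega> 0 = fst z i" using fst_iter[OF z, of m] K m by simp
    ultimately show ?thesis using fst_undigits[OF m(1)] m(2) by simp
  qed
  then have "fst (undigits \<beta> ?d) = fst z" by auto
  moreover have "snd (undigits \<beta> ?d) = snd z" by (simp add: undigits_def val_digits[OF z])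
  ultimately show ?thesis by (simp add: prod_eq_iff)
qed

private lemma d1_undigits:
  assumes d: "\<And>i. d i \<le> n"
  shows "d1 \<beta> (undigits \<beta> d) = d 0"
proof -
  have v: "visits \<beta> d 0 \<longleftrightarrow> val \<beta> d \<in> switch_region \<beta>" by (simp add: visits_def)
  have c: "visit_count \<beta> d 0 = 0" by (simp add: visit_count_def)
  have J1: "val \<beta> d \<in> J_beta \<beta>" using val_in_J[of d] d by blast
  have "val \<beta> (\<lambda>i. d (Suc i)) \<in> J_beta \<beta>" using val_in_J[of "\<lambda>i. d (Suc i)"] d by blast
  then have J2: "\<beta> * val \<beta> d - real (d 0) \<in> J_beta \<beta>" using val_step[of d] d by metis
  have "fst (undigits \<beta> d) 0 \<longleftrightarrow> 1 \<le> d 0 \<and> val \<beta> d \<in> switch \<beta> (d 0)"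
    if "val \<beta> d \<in> switch_region \<beta>"
    using fst_undigits[of d 0] v c that by (simp add: coin_at_def)
  then have "d1 \<beta> (fst (undigits \<beta> d), val \<beta> d) = d 0"
    using d1_char[OF J1 d J2] by blast
  then show ?thesis by (simp add: undigits_def)
qed

private lemma INFM_shift:
  assumes "\<exists>\<^sub>\<infinity>l. P l"
  shows "\<exists>\<^sub>\<infinity>l. P (l + (m::nat))"
  unfolding INFM_nat
proof
  fix k
  obtain l where "l > k + m" "P l" using assms unfolding INFM_nat by blast
  then show "\<exists>l>k. P (l + m)" by (intro exI[of _ "l - m"]) auto
qed

private lemma visits_Suc: "visits \<beta> (\<lambda>i. d (Suc i)) m \<longleftrightarrow> visits \<beta> d (Suc m)"
  by (simp add: visits_def)

private lemma visit_count_Suc: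
  "visit_count \<beta> d (Suc m) =
    visit_count \<beta> (\<lambda>i. d (Suc i)) m + (if visits \<beta> d 0 then 1 else 0)"
  unfolding visit_count_def by (subst sum.lessThan_Suc_shift) (simp add: visits_Suc)

private lemma coin_at_Suc: "coin_at \<beta> (\<lambda>i. d (Suc i)) m \<longleftrightarrow> coin_at \<beta> d (Suc m)"
  by (simp add: coin_at_def)

private lemma K_undigits:
  assumes d: "\<And>i. d i \<le> n" and inf: "\<exists>\<^sub>\<infinity>m. visits \<beta> d m"
  shows "K_beta \<beta> (undigits \<beta> d) = undigits \<beta> (\<lambda>i. d (Suc i))"
proof -
  have inf': "\<exists>\<^sub>\<infinity>m. visits \<beta> (\<lambda>i. d (Suc i)) m"
    using INFM_shift[OF inf, of 1] by (simp add: visits_Suc)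
  let ?s = "if visits \<beta> d 0 then 1 else (0::nat)"
  have "fst (undigits \<beta> d) (i + ?s) \<longleftrightarrow> fst (undigits \<beta> (\<lambda>i. d (Suc i))) i" for i
  proof -
    obtain m where m: "visits \<beta> (\<lambda>i. d (Suc i)) m" "visit_count \<beta> (\<lambda>i. d (Suc i)) m = i"
      using visit_count_hits[OF inf'] by blast
    show ?thesis
      using fst_undigits[of "\<lambda>i. d (Suc i)" m] fst_undigits[of d "Suc m"] m
      by (simp add: visits_Suc visit_count_Suc coin_at_Suc)
  qed
  then have "fst (undigits \<beta> (\<lambda>i. d (Suc i))) =
      (if visits \<beta> d 0 then shift (fst (undigits \<beta> d)) else fst (undigits \<beta> d))"
    by (auto simp: shift_def split: if_splits)
  moreover have "fst (K_beta \<beta> (undigits \<beta> d)) =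
      (if visits \<beta> d 0 then shift (fst (undigits \<beta> d)) else fst (undigits \<beta> d))"
    by (simp add: K_beta_def undigits_def visits_def)
  moreover have "snd (K_beta \<beta> (undigits \<beta> d)) = \<beta> * val \<beta> d - real (d1 \<beta> (undigits \<beta> d))"
    by (simp add: K_beta_def undigits_def)
  ultimately show ?thesis
    using d1_undigits[of d] val_step[of d] d by (simp add: prod_eq_iff undigits_def)
qed

private lemma iter_undigits:
  assumes d: "\<And>i. d i \<le> n" and inf: "\<exists>\<^sub>\<infinity>m. visits \<beta> d m"
  shows "(K_beta \<beta> ^^ m) (undigits \<beta> d) = undigits \<beta> (\<lambda>i. d (i + m))"
proof (induction m)
  case (Suc m)
  have "visits \<beta> (\<lambda>i. d (i + m)) l \<longleftrightarrow> visits \<beta> d (l + m)" for l by (simp add: visits_def ac_simps)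
  then have "\<exists>\<^sub>\<infinity>l. visits \<beta> (\<lambda>i. d (i + m)) l"
    using INFM_shift[OF inf, of m] by simp
  then show ?case using Suc K_undigits[of "\<lambda>i. d (i + m)"] d by simp
qed simp

private lemma image_digits:
  "digits \<beta> ` (Z_beta \<beta> \<inter> A) =
    {d. (\<forall>i. d i \<le> n) \<and> (\<exists>\<^sub>\<infinity>m. visits \<beta> d m) \<and> undigits \<beta> d \<in> A}"
proof (intro set_eqI iffI)
  fix d assume "d \<in> digits \<beta> ` (Z_beta \<beta> \<inter> A)"
  then obtain z where z: "z \<in> Z_beta \<beta>" "z \<in> A" "d = digits \<beta> z" by auto
  then have zJ: "z \<in> UNIV \<times> J_beta \<beta>" by (simp add: Z_beta_def)
  have inf: "\<exists>\<^sub>\<infinity>m. visits \<beta> (digits \<beta> z) m"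
    using z(1) by (simp add: Z_beta_def visits_iter[OF zJ])
  show "d \<in> {d. (\<forall>i. d i \<le> n) \<and> (\<exists>\<^sub>\<infinity>m. visits \<beta> d m) \<and> undigits \<beta> d \<in> A}"
    using z digits_le[OF zJ] undigits_digits[OF z(1)] inf by simp
next
  fix d assume "d \<in> {d. (\<forall>i. d i \<le> n) \<and> (\<exists>\<^sub>\<infinity>m. visits \<beta> d m) \<and> undigits \<beta> d \<in> A}"
  then have d: "\<And>i. d i \<le> n" "\<exists>\<^sub>\<infinity>m. visits \<beta> d m" "undigits \<beta> d \<in> A" by auto
  have "d1 \<beta> (undigits \<beta> (\<lambda>i. d (i + m))) = d m" for m
    using d1_undigits[of "\<lambda>i. d (i + m)"] d(1) by simp
  then have eq: "digits \<beta> (undigits \<beta> d) = d"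
    by (simp add: digits_def iter_undigits[OF d(1,2)])
  have uJ: "undigits \<beta> d \<in> UNIV \<times> J_beta \<beta>"
    using val_in_J[of d] d(1) by (simp add: undigits_def)
  have "\<exists>\<^sub>\<infinity>m. (K_beta \<beta> ^^ m) (undigits \<beta> d) \<in> UNIV \<times> switch_region \<beta>"
    using d(2) visits_iter[OF uJ, unfolded eq] by simp
  with uJ have "undigits \<beta> d \<in> Z_beta \<beta>" by (simp add: Z_beta_def)
  with d(3) have "digits \<beta> (undigits \<beta> d) \<in> digits \<beta> ` (Z_beta \<beta> \<inter> A)" by blast
  then show "d \<in> digits \<beta> ` (Z_beta \<beta> \<inter> A)" by (simp only: eq)
qed

private lemma space_digit: "space (digit_measure \<beta>) = {d. \<forall>i. d i \<le> n}"
  by (auto simp: digit_measure_def space_PiM PiE_def Pi_def n_def space_uniform_count_measure)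

private lemma meas_coord [measurable]: "(\<lambda>d. d i) \<in> digit_measure \<beta> \<rightarrow>\<^sub>M count_space UNIV"
proof -
  have "(\<lambda>d. d i) \<in> digit_measure \<beta> \<rightarrow>\<^sub>M uniform_count_measure {0..maxdigit \<beta>}"
    unfolding digit_measure_def by (rule measurable_component_singleton) simp
  then show ?thesis
    by (rule measurable_compose) (auto simp: measurable_def sets_uniform_count_measure space_uniform_count_measure)
qed

private lemma meas_val [measurable]:
  "(\<lambda>d. val \<beta> (\<lambda>i. d (i + m))) \<in> borel_measurable (digit_measure \<beta>)"
  unfolding val_def by measurable

private lemma meas_visits [measurable]: "Measurable.pred (digit_measure \<beta>) (\<lambda>d. visits \<beta> d m)"
proof -
  have "switch_region \<beta> \<in> sets borel" by (auto simp: switch_region_def switch_def)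
  then show ?thesis unfolding visits_def by measurable
qed

private lemma meas_count [measurable]:
  "(\<lambda>d. visit_count \<beta> d m) \<in> digit_measure \<beta> \<rightarrow>\<^sub>M count_space UNIV"
  unfolding visit_count_def by measurable

private lemma meas_coin [measurable]: "Measurable.pred (digit_measure \<beta>) (\<lambda>d. coin_at \<beta> d m)"
  unfolding coin_at_def switch_iff by measurable

private lemma meas_undigits: "undigits \<beta> \<in> digit_measure \<beta> \<rightarrow>\<^sub>M phase_space \<beta>"
  unfolding phase_space_def undigits_def[abs_def]
proof (rule measurable_Pair)
  show "(\<lambda>d i. \<exists>m. visits \<beta> d m \<and> visit_count \<beta> d m = i \<and> coin_at \<beta> d m)
      \<in> digit_measure \<beta> \<rightarrow>\<^sub>M (\<Pi>\<^sub>M i\<in>UNIV. count_space UNIV)"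
    by (rule measurable_PiM_single') auto
  have "val \<beta> \<in> borel_measurable (digit_measure \<beta>)" using meas_val[of 0] by simp
  then show "val \<beta> \<in> digit_measure \<beta> \<rightarrow>\<^sub>M restrict_space borel (J_beta \<beta>)"
    using val_in_J by (intro measurable_restrict_space2) (auto simp: space_digit)
qed

private lemma meas_inf: "Measurable.pred (digit_measure \<beta>) (\<lambda>d. \<exists>\<^sub>\<infinity>m. visits \<beta> d m)"
  unfolding INFM_nat by measurable

lemma sets_digits_image:
  assumes A: "A \<in> sets (phase_space \<beta>)"
  shows "digits \<beta> ` (Z_beta \<beta> \<inter> A) \<in> sets (digit_measure \<beta>)"
proof -
  have "digits \<beta> ` (Z_beta \<beta> \<inter> A) =
      {d \<in> space (digit_measure \<beta>). \<exists>\<^sub>\<infinity>m. visits \<beta> d m} \<inter>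
      (undigits \<beta> -` A \<inter> space (digit_measure \<beta>))"
    unfolding image_digits space_digit by blast
  moreover have "{d \<in> space (digit_measure \<beta>). \<exists>\<^sub>\<infinity>m. visits \<beta> d m} \<in> sets (digit_measure \<beta>)"
    using meas_inf by (rule predE)
  ultimately show ?thesis using measurable_sets[OF meas_undigits A] by simp
qed

lemma inj_on_digits: "inj_on (digits \<beta>) (Z_beta \<beta>)"
  using undigits_digits by (metis inj_onI)

lemma emeasure_nu:
  assumes A: "A \<in> sets (phase_space \<beta>)"
  shows "emeasure (nu \<beta>) A = emeasure (digit_measure \<beta>) (digits \<beta> ` (Z_beta \<beta> \<inter> A))"
  unfolding nu_def
proof (rule emeasure_measure_of_sigma)
  let ?\<mu> = "\<lambda>A. emeasure (digit_measure \<beta>) (digits \<beta> ` (Z_beta \<beta> \<inter> A))"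
  show "sigma_algebra (space (phase_space \<beta>)) (sets (phase_space \<beta>))" ..
  show "positive (sets (phase_space \<beta>)) ?\<mu>" by (simp add: positive_def)
  show "countably_additive (sets (phase_space \<beta>)) ?\<mu>"
  proof (rule countably_additiveI)
    fix B :: "nat \<Rightarrow> _" assume B: "range B \<subseteq> sets (phase_space \<beta>)" "disjoint_family B"
    have "(\<Sum>i. ?\<mu> (B i)) = emeasure (digit_measure \<beta>) (\<Union>i. digits \<beta> ` (Z_beta \<beta> \<inter> B i))"
    proof (rule suminf_emeasure)
      show "range (\<lambda>i. digits \<beta> ` (Z_beta \<beta> \<inter> B i)) \<subseteq> sets (digit_measure \<beta>)"
        using B(1) sets_digits_image by blast
      have "digits \<beta> ` (Z_beta \<beta> \<inter> B i) \<inter> digits \<beta> ` (Z_beta \<beta> \<inter> B j) = {}" if "i \<noteq> j" for i j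
      proof -
        have "(Z_beta \<beta> \<inter> B i) \<inter> (Z_beta \<beta> \<inter> B j) = {}"
          using B(2) that by (auto simp: disjoint_family_on_def)
        then show ?thesis
          using inj_on_image_Int[OF inj_on_digits, of "Z_beta \<beta> \<inter> B i" "Z_beta \<beta> \<inter> B j"] by simp
      qed
      then show "disjoint_family (\<lambda>i. digits \<beta> ` (Z_beta \<beta> \<inter> B i))"
        by (auto simp only: disjoint_family_on_def)
    qed
    also have "(\<Union>i. digits \<beta> ` (Z_beta \<beta> \<inter> B i)) = digits \<beta> ` (Z_beta \<beta> \<inter> (\<Union>i. B i))" by auto
    finally show "(\<Sum>i. ?\<mu> (B i)) = ?\<mu> (\<Union>i. B i)" .
  qed
qed (rule A)

end

lemma sets_nu: "sets (nu \<beta>) = sets (phase_space \<beta>)"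
  unfolding nu_def by (simp add: sets_measure_of[OF sets.space_closed] sets.sigma_sets_eq)

lemma sets_coin_lebesgue:
  "sets (coin_measure p \<Otimes>\<^sub>M normalized_lebesgue \<beta>) = sets (phase_space \<beta>)"
  unfolding coin_measure_def normalized_lebesgue_def phase_space_def
  by (intro sets_pair_measure_cong sets_PiM_cong)
     (simp_all add: sets_restrict_space)

lemma prob_space_normalized_lebesgue:
  assumes "\<beta> > 1"
  shows "prob_space (normalized_lebesgue \<beta>)"
  unfolding normalized_lebesgue_def
proof (rule prob_space_uniform_measure)
  have J: "J_beta \<beta> \<in> sets lborel" by (simp add: J_beta_def)
  have "maxdigit \<beta> > 0" using assms by (simp add: maxdigit_def)
  then have pos: "0 < real (maxdigit \<beta>) / (\<beta> - 1)" using assms by simp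
  have "emeasure (restrict_space lborel (J_beta \<beta>)) (J_beta \<beta>) = ennreal (real (maxdigit \<beta>) / (\<beta> - 1))"
    using J pos by (subst emeasure_restrict_space) (auto simp: J_beta_def)
  with pos show "emeasure (restrict_space lborel (J_beta \<beta>)) (J_beta \<beta>) \<noteq> 0"
    "emeasure (restrict_space lborel (J_beta \<beta>)) (J_beta \<beta>) \<noteq> \<infinity>"
    by (simp_all only: ennreal_eq_0_iff not_le infinity_ennreal_def ennreal_neq_top not_False_eq_True)
qed

end

theory Submission
  imports Defs
begin

text \<open>
  Write \<open>P(w) = (n + 1)\<^sup>-\<^sup>N\<close> and \<open>Q(w)\<close> for the masses that \<open>\<nu>\<close> and \<open>m\<^sub>p \<otimes> \<lambda>\<close> give to the
  cylinder of a digit word \<open>w\<close> of length \<open>N\<close>, where \<open>n = \<lfloor>\<beta>\<rfloor>\<close>, and put \<open>g = P / (P + Q)\<close>.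
  Along longer and longer words \<open>g\<close> is a bounded martingale for \<open>P + Q\<close>, so its \<open>L\<^sup>2\<close> increments
  tend to \<open>0\<close>: for a fixed word \<open>v\<close>, \<open>g(uv)\<close> and \<open>g(u)\<close> are close on average over \<open>u\<close>.
  On the other hand, replacing \<open>u0\<^sup>m\<close> by \<open>u0\<^sup>m\<^sup>+\<^sup>1\<close> divides \<open>P\<close> by \<open>n + 1\<close>, but it divides \<open>Q\<close> by
  \<open>\<beta> < n + 1\<close> as soon as the cylinder of \<open>u0\<^sup>m\<close> is not cut by the boundary of a switch region
  within the first \<open>|u|\<close> steps: for each coin sequence the contraction by \<open>1 / \<beta>\<close> towards the left
  end point of the cylinder of \<open>u\<close> then maps one cylinder onto the other.  Hence \<open>g(u)\<close> must be close
  to \<open>1\<close> on average over such \<open>u\<close>, and by a small ball estimate all but an arbitrarily small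
  \<open>P\<close>-proportion of the words, uniformly in \<open>N\<close>, are such \<open>u\<close> once \<open>m\<close> is large.  So the overlap
  \<open>\<Sum>\<^sub>w min (P(w)) (Q(w))\<close> tends to \<open>0\<close> and Borel--Cantelli gives singularity.
\<close>

section \<open>Words over a finite alphabet\<close>

definition words :: "nat \<Rightarrow> nat \<Rightarrow> nat list set" where
  "words n N = {w. set w \<subseteq> {..n} \<and> length w = N}"

lemma finite_words [simp]: "finite (words n N)"
  unfolding words_def by (rule finite_lists_length_eq) simp

lemma words_0 [simp]: "words n 0 = {[]}"
  by (auto simp: words_def)

lemma card_words: "card (words n N) = (n + 1) ^ N"
  unfolding words_def by (subst card_lists_length_eq) auto

lemma length_words: "w \<in> words n N \<Longrightarrow> length w = N"
  by (simp add: words_def)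

lemma words_Suc: "words n (Suc N) = (\<lambda>(k, w). k # w) ` ({..n} \<times> words n N)"
proof (intro set_eqI iffI)
  fix w assume "w \<in> words n (Suc N)"
  then show "w \<in> (\<lambda>(k, w). k # w) ` ({..n} \<times> words n N)"
    by (cases w) (auto simp: words_def)
qed (auto simp: words_def)

lemma sum_words_Suc: "(\<Sum>w\<in>words n (Suc N). f w) = (\<Sum>k\<le>n. \<Sum>w\<in>words n N. f (k # w))"
  unfolding words_Suc
  by (subst sum.reindex) (auto simp: inj_on_def sum.cartesian_product case_prod_beta)

lemma sum_words_add: "(\<Sum>w\<in>words n (N + l). f w) = (\<Sum>u\<in>words n N. \<Sum>v\<in>words n l. f (u @ v))"
  by (induction N arbitrary: f) (simp_all add: sum_words_Suc)

lemma replicate_words: "k \<le> n \<Longrightarrow> replicate N k \<in> words n N"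
  by (auto simp: words_def)

section \<open>Overlap of two families of cylinder weights\<close>

text \<open>The masses that two probability measures give to the cylinders of digit words, reduced
  to consistency under appending a letter. Positivity of \<open>p\<close> keeps the quotient
  \<open>g\<close> meaningful on every word.\<close>

locale cylinder_weights =
  fixes n :: nat and p q :: "nat list \<Rightarrow> real"
  assumes p_pos: "p w > 0" and q_nonneg: "q w \<ge> 0"
    and p_Nil: "p [] = 1" and q_Nil: "q [] = 1"
    and p_split: "(\<Sum>k\<le>n. p (w @ [k])) = p w"
    and q_split: "set w \<subseteq> {..n} \<Longrightarrow> (\<Sum>k\<le>n. q (w @ [k])) = q w"
begin

section \<open>Likelihood ratio martingale and its energy\<close>

definition r :: "nat list \<Rightarrow> real" where "r w = p w + q w"

definition g :: "nat list \<Rightarrow> real" where "g w = p w / r w"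

text \<open>As \<open>(p w)^2 / r w = r w * (g w)^2\<close>, this is the second moment of the
  martingale \<open>g\<close> at level \<open>N\<close> under the weights \<open>r\<close>.\<close>

definition energy :: "nat \<Rightarrow> real" where "energy N = (\<Sum>w\<in>words n N. (p w)\<^sup>2 / r w)"

lemma r_pos: "r w > 0"
  using p_pos[of w] q_nonneg[of w] by (simp add: r_def)

lemma p_extend: "set u \<subseteq> {..n} \<Longrightarrow> (\<Sum>v\<in>words n l. p (u @ v)) = p u"
proof (induction l arbitrary: u)
  case (Suc l)
  have "(\<Sum>v\<in>words n (Suc l). p (u @ v)) = (\<Sum>k\<le>n. \<Sum>v\<in>words n l. p ((u @ [k]) @ v))"
    by (simp add: sum_words_Suc)
  also have "\<dots> = (\<Sum>k\<le>n. p (u @ [k]))"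
    using Suc.prems by (intro sum.cong refl Suc.IH) auto
  finally show ?case using p_split by simp
qed simp

lemma q_extend: "set u \<subseteq> {..n} \<Longrightarrow> (\<Sum>v\<in>words n l. q (u @ v)) = q u"
proof (induction l arbitrary: u)
  case (Suc l)
  have "(\<Sum>v\<in>words n (Suc l). q (u @ v)) = (\<Sum>k\<le>n. \<Sum>v\<in>words n l. q ((u @ [k]) @ v))"
    by (simp add: sum_words_Suc)
  also have "\<dots> = (\<Sum>k\<le>n. q (u @ [k]))"
    using Suc.prems by (intro sum.cong refl Suc.IH) auto
  finally show ?case using q_split Suc.prems by simp
qed simp

lemma p_total: "(\<Sum>w\<in>words n N. p w) = 1" and q_total: "(\<Sum>w\<in>words n N. q w) = 1"
  using p_extend[of "[]" N] q_extend[of "[]" N] by (simp_all add: p_Nil q_Nil)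

text \<open>The \<open>r\<close>-average of \<open>g\<close> over the extensions of \<open>u\<close>
  is \<open>g u\<close>, so this is the conditional variance identity: second moment minus squared
  mean.\<close>

lemma variance:
  assumes "set u \<subseteq> {..n}"
  shows "(\<Sum>v\<in>words n l. r (u @ v) * (g (u @ v) - g u)\<^sup>2)
    = (\<Sum>v\<in>words n l. (p (u @ v))\<^sup>2 / r (u @ v)) - (p u)\<^sup>2 / r u"
proof -
  have "r w * (g w - a)\<^sup>2 = (p w)\<^sup>2 / r w - 2 * a * p w + a\<^sup>2 * r w" for w a
    using r_pos[of w] by (simp add: g_def field_simps power2_eq_square)
  then have "(\<Sum>v\<in>words n l. r (u @ v) * (g (u @ v) - g u)\<^sup>2)
    = (\<Sum>v\<in>words n l. (p (u @ v))\<^sup>2 / r (u @ v)) - 2 * g u * (\<Sum>v\<in>words n l. p (u @ v))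
      + (g u)\<^sup>2 * (\<Sum>v\<in>words n l. r (u @ v))"
    by (simp add: sum.distrib sum_subtractf sum_distrib_left)
  also have "(\<Sum>v\<in>words n l. r (u @ v)) = r u"
    using p_extend q_extend assms by (simp add: r_def sum.distrib)
  also have "(\<Sum>v\<in>words n l. p (u @ v)) = p u" using p_extend assms by simp
  finally show ?thesis
    using r_pos[of u] by (simp add: g_def field_simps power2_eq_square)
qed

text \<open>Summing \<open>variance\<close> over \<open>u\<close> gives the whole energy difference,
  and the fixed suffix \<open>v\<close> contributes only some of its nonnegative terms.\<close>

lemma energy_gap:
  assumes "v \<in> words n l"
  shows "(\<Sum>u\<in>words n N. r (u @ v) * (g (u @ v) - g u)\<^sup>2) \<le> energy (N + l) - energy N"
proof -
  have "(\<Sum>u\<in>words n N. r (u @ v) * (g (u @ v) - g u)\<^sup>2)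
      \<le> (\<Sum>u\<in>words n N. \<Sum>v\<in>words n l. r (u @ v) * (g (u @ v) - g u)\<^sup>2)"
    using assms r_pos[THEN less_imp_le] by (intro sum_mono member_le_sum) auto
  also have "\<dots> = (\<Sum>u\<in>words n N. (\<Sum>v\<in>words n l. (p (u @ v))\<^sup>2 / r (u @ v)) - (p u)\<^sup>2 / r u)"
    by (intro sum.cong refl variance) (simp add: words_def)
  finally show ?thesis by (simp add: energy_def sum_words_add sum_subtractf)
qed

text \<open>The energy increases by \<open>energy_gap\<close> and stays below 1 because
  \<open>g \<le> 1\<close>; hence it converges and its increments at a fixed lag vanish.\<close>

lemma energy_Cauchy: "(\<lambda>N. energy (N + l) - energy N) \<longlonglongrightarrow> 0"
proof -
  have "energy N \<le> energy (Suc N)" for N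
    using energy_gap[OF replicate_words[of 0 n 1], of N] r_pos
    by (smt (verit) Suc_eq_plus1 le0 mult_nonneg_nonneg sum_nonneg zero_le_power2)
  then have "incseq energy" by (rule incseq_SucI)
  moreover have "energy N \<le> 1" for N
  proof -
    have "(p w)\<^sup>2 / r w \<le> p w" for w
      using p_pos[of w] q_nonneg[of w] r_pos[of w]
      by (simp add: r_def field_simps power2_eq_square)
    then have "energy N \<le> (\<Sum>w\<in>words n N. p w)" unfolding energy_def by (rule sum_mono)
    then show ?thesis by (simp add: p_total)
  qed
  ultimately obtain L where "energy \<longlonglongrightarrow> L" by (metis incseq_convergent)
  then have "(\<lambda>N. energy (N + l) - energy N) \<longlonglongrightarrow> L - L"
    by (intro tendsto_diff LIMSEQ_ignore_initial_segment)
  then show ?thesis by simp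
qed

text \<open>Always \<open>r w * (g w - g u) = (1 - g u) * p w - g u * q w\<close>. Taking
  \<open>w\<close> to be \<open>u\<close> followed by \<open>m\<close> zeros, dividing by
  \<open>b\<close> and subtracting the same expression for \<open>m + 1\<close> zeros cancels the
  \<open>q\<close> terms. What remains is a fixed positive multiple of
  \<open>(1 - g u) * p u = p u * q u / r u\<close>, so the overlap at a good \<open>u\<close> is
  bounded by martingale increments.\<close>

lemma overlap_vanishes:
  fixes b :: real
  assumes pw: "\<And>w. p w = 1 / real (n + 1) ^ length w"
    and b: "1 < b" "b < real n + 1"
    and good: "\<And>\<epsilon>. \<epsilon> > 0 \<Longrightarrow> \<exists>m. \<forall>N. \<exists>G\<subseteq>words n N. (\<Sum>u\<in>words n N - G. p u) \<le> \<epsilon> \<and>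
      (\<forall>u\<in>G. q (u @ replicate (Suc m) 0) = q (u @ replicate m 0) / b)"
    and \<epsilon>: "\<epsilon> > 0"
  shows "\<exists>N. (\<Sum>w\<in>words n N. min (p w) (q w)) < \<epsilon>"
proof -
  from good[of "\<epsilon> / 8"] \<epsilon> obtain m where good: "\<And>N. \<exists>G\<subseteq>words n N. (\<Sum>u\<in>words n N - G. p u) \<le> \<epsilon> / 8 \<and>
      (\<forall>u\<in>G. q (u @ replicate (Suc m) 0) = q (u @ replicate m 0) / b)" by auto
  define v where "v = replicate m (0::nat)"
  define v' where "v' = replicate (Suc m) (0::nat)"
  have v: "v \<in> words n m" "v' \<in> words n (Suc m)"
    unfolding v_def v'_def by (auto intro!: replicate_words simp del: replicate_Suc)
  \<comment> \<open>Chosen so that \<open>p u * \<kappa> = p (u @ v) / b - p (u @ v')\<close>; it is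
    positive because \<open>b < n + 1\<close>.\<close>
  define \<kappa> where "\<kappa> = (1 / b - 1 / real (n + 1)) / real (n + 1) ^ m"
  have \<kappa>: "\<kappa> > 0" unfolding \<kappa>_def using b by (simp add: frac_less2)
  \<comment> \<open>With \<open>\<tau>\<close> and \<open>\<delta>\<close> as chosen, \<open>2 * (2
    * \<tau> + \<delta> / \<tau>) = 3 * \<epsilon> / 32 * \<kappa>\<close>. The good words then
    carry overlap at most \<open>3 * \<epsilon> / 16\<close> and the others at most
    \<open>\<epsilon> / 8\<close>.\<close>
  define \<tau> where "\<tau> = \<kappa> * \<epsilon> / 64"
  have \<tau>: "\<tau> > 0" using \<kappa> \<epsilon> by (simp add: \<tau>_def)
  define \<delta> where "\<delta> = \<tau> * \<kappa> * \<epsilon> / 64"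
  have \<delta>: "\<delta> > 0" using \<kappa> \<epsilon> \<tau> by (simp add: \<delta>_def)
  have "\<forall>\<^sub>F N in sequentially. energy (N + m) - energy N < \<delta>"
    "\<forall>\<^sub>F N in sequentially. energy (N + Suc m) - energy N < \<delta>"
    using order_tendstoD(2)[OF energy_Cauchy \<delta>] by blast+
  then have "\<forall>\<^sub>F N in sequentially. energy (N + m) - energy N < \<delta> \<and> energy (N + Suc m) - energy N < \<delta>"
    by eventually_elim simp
  then obtain N where N: "energy (N + m) - energy N < \<delta>" "energy (N + Suc m) - energy N < \<delta>"
    unfolding eventually_sequentially by blast
  obtain G where G: "G \<subseteq> words n N" "(\<Sum>u\<in>words n N - G. p u) \<le> \<epsilon> / 8"
      "\<And>u. u \<in> G \<Longrightarrow> q (u @ v') = q (u @ v) / b"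
    using good[of N] unfolding v_def v'_def by blast
  define D where "D u s = r (u @ s) * \<bar>g (u @ s) - g u\<bar>" for u s
  have D: "(\<Sum>u\<in>words n N. D u s) \<le> 2 * \<tau> + \<delta> / \<tau>"
    if s: "s \<in> words n l" "energy (N + l) - energy N < \<delta>" for s l
  proof -
    \<comment> \<open>Passes from second to first moments of the increments; the terms
      \<open>\<tau> * R\<close> add up to at most \<open>2 * \<tau>\<close>, since \<open>r\<close>
      has total mass 2 on each level.\<close>
    have amgm: "R * \<bar>t\<bar> \<le> \<tau> * R + R * t\<^sup>2 / \<tau>" if "R > 0" for R t :: real
    proof -
      have "0 \<le> (\<tau> - \<bar>t\<bar>)\<^sup>2 + \<tau> * \<bar>t\<bar>" using \<tau> by simp
      then have "\<bar>t\<bar> * \<tau> \<le> \<tau>\<^sup>2 + t\<^sup>2"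
        by (simp add: power2_diff algebra_simps)
      then have "\<bar>t\<bar> \<le> \<tau> + t\<^sup>2 / \<tau>" using \<tau> by (simp add: field_simps power2_eq_square)
      then have "R * \<bar>t\<bar> \<le> R * (\<tau> + t\<^sup>2 / \<tau>)" using that by (intro mult_left_mono) auto
      then show ?thesis by (simp add: algebra_simps)
    qed
    have "(\<Sum>u\<in>words n N. D u s) \<le> (\<Sum>u\<in>words n N. \<tau> * r (u @ s) + r (u @ s) * (g (u @ s) - g u)\<^sup>2 / \<tau>)"
      unfolding D_def by (intro sum_mono amgm r_pos)
    also have "\<dots> = \<tau> * (\<Sum>u\<in>words n N. r (u @ s)) + (\<Sum>u\<in>words n N. r (u @ s) * (g (u @ s) - g u)\<^sup>2) / \<tau>"
      by (simp add: sum.distrib sum_distrib_left sum_divide_distrib)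
    also have "\<dots> \<le> \<tau> * 2 + \<delta> / \<tau>"
    proof (intro add_mono mult_left_mono divide_right_mono)
      have "(\<Sum>u\<in>words n N. r (u @ s)) \<le> (\<Sum>u\<in>words n N. \<Sum>s\<in>words n l. r (u @ s))"
        using s r_pos by (intro sum_mono member_le_sum) (auto intro: less_imp_le)
      also have "\<dots> = (\<Sum>w\<in>words n (N + l). r w)" by (simp add: sum_words_add)
      also have "\<dots> = 2" by (simp add: r_def sum.distrib p_total q_total)
      finally show "(\<Sum>u\<in>words n N. r (u @ s)) \<le> 2" .
    qed (use \<tau> energy_gap[OF s(1), of N] s(2) in auto)
    finally show ?thesis by simp
  qed
  have key: "p u * q u / r u * \<kappa> \<le> D u v + D u v'" if u: "u \<in> G" for u
  proof -
    have dev: "r w * (g w - g u) = (1 - g u) * p w - g u * q w" for w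
    proof -
      have "r w * g w = p w" using r_pos[of w] by (simp add: g_def)
      then show ?thesis by (simp add: r_def algebra_simps)
    qed
    have pv: "p (u @ v) = p u / real (n + 1) ^ m" "p (u @ v') = p (u @ v) / real (n + 1)"
      by (simp_all add: pw v_def v'_def power_add)
    have "p u * q u / r u = (1 - g u) * p u"
      using r_pos[of u] by (simp add: g_def r_def field_simps)
    then have "p u * q u / r u * \<kappa> = (1 - g u) * (p u * \<kappa>)" by simp
    also have "p u * \<kappa> = p (u @ v) / b - p (u @ v')"
      unfolding pv by (simp add: \<kappa>_def diff_divide_distrib right_diff_distrib mult.commute)
    also have "(1 - g u) * (p (u @ v) / b - p (u @ v'))
      = ((1 - g u) * p (u @ v) - g u * q (u @ v)) / b - ((1 - g u) * p (u @ v') - g u * q (u @ v'))"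
      using b by (simp add: G(3)[OF u] field_simps)
    finally have "p u * q u / r u * \<kappa> = r (u @ v) * (g (u @ v) - g u) / b - r (u @ v') * (g (u @ v') - g u)"
      by (simp only: dev)
    moreover have "r (u @ v) * (g (u @ v) - g u) / b \<le> D u v"
    proof -
      have "r (u @ v) * (g (u @ v) - g u) / b \<le> D u v / b"
        unfolding D_def using b r_pos[of "u @ v"] by (intro divide_right_mono mult_left_mono) auto
      also have "\<dots> \<le> D u v"
        using b r_pos[of "u @ v"] mult_left_mono[of 1 b "D u v"] by (simp add: D_def field_simps)
      finally show ?thesis .
    qed
    moreover have "- (r (u @ v') * (g (u @ v') - g u)) \<le> D u v'"
      unfolding D_def using r_pos[of "u @ v'"]
      by (metis abs_ge_minus_self abs_mult abs_of_pos)
    ultimately show ?thesis by linarith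
  qed
  \<comment> \<open>The minimum is at most the harmonic mean
    \<open>2 * p w * q w / (p w + q w)\<close>.\<close>
  have min_le: "min (p w) (q w) \<le> 2 * (p w * q w / r w)" for w
    using p_pos[of w] q_nonneg[of w] r_pos[of w] mult_left_mono[of "p w" "q w" "q w"]
      mult_right_mono[of "q w" "p w" "q w"]
    by (auto simp: r_def min_def field_simps)
  have "(\<Sum>u\<in>G. p u * q u / r u) * \<kappa> \<le> (\<Sum>u\<in>G. D u v + D u v')"
    unfolding sum_distrib_right by (intro sum_mono key)
  also have "\<dots> \<le> (\<Sum>u\<in>words n N. D u v + D u v')"
    using G(1) r_pos[THEN less_imp_le] by (intro sum_mono2) (auto simp: D_def)
  also have "\<dots> \<le> 2 * (2 * \<tau> + \<delta> / \<tau>)"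
    using D[OF v(1) N(1)] D[OF v(2) N(2)] by (simp add: sum.distrib)
  also have "\<dots> = 3 * \<epsilon> / 32 * \<kappa>"
    using \<tau> by (simp add: \<delta>_def) (simp add: \<tau>_def)
  finally have "(\<Sum>u\<in>G. p u * q u / r u) \<le> 3 * \<epsilon> / 32" using \<kappa> by simp
  moreover have "(\<Sum>u\<in>G. min (p u) (q u)) \<le> 2 * (\<Sum>u\<in>G. p u * q u / r u)"
    unfolding sum_distrib_left by (intro sum_mono min_le)
  moreover have "(\<Sum>u\<in>words n N - G. min (p u) (q u)) \<le> (\<Sum>u\<in>words n N - G. p u)"
    by (intro sum_mono) simp
  moreover have "(\<Sum>w\<in>words n N. min (p w) (q w))
      = (\<Sum>u\<in>words n N - G. min (p u) (q u)) + (\<Sum>u\<in>G. min (p u) (q u))"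
    by (rule sum.subset_diff[OF G(1)]) simp
  ultimately have "(\<Sum>w\<in>words n N. min (p w) (q w)) < \<epsilon>" using G(2) \<epsilon> by linarith
  then show ?thesis ..
qed

end

section \<open>A small ball estimate\<close>

text \<open>The finite expansion \<open>\<Sum>i. w ! i / \<beta> ^ (i + 1)\<close>; by
  \<open>starts_point\<close> it is a lower bound for all points of \<open>J_beta \<beta>\<close>
  whose digits start with \<open>w\<close>.\<close>

primrec word_val :: "real \<Rightarrow> nat list \<Rightarrow> real" where
  "word_val \<beta> [] = 0"
| "word_val \<beta> (k # w) = (real k + word_val \<beta> w) / \<beta>"

lemma word_val_nonneg: "\<beta> > 0 \<Longrightarrow> word_val \<beta> w \<ge> 0"
  by (induction w) auto

lemma word_val_append: "word_val \<beta> (u @ w) = word_val \<beta> u + word_val \<beta> w / \<beta> ^ length u"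
  by (induction u) (simp_all add: add_divide_distrib mult.commute)

lemma word_val_replicate_0 [simp]: "word_val \<beta> (replicate N 0) = 0"
  by (induction N) auto

lemma word_val_replicate:
  assumes "\<beta> > 1"
  shows "word_val \<beta> (replicate N k) = real k / (\<beta> - 1) * (1 - 1 / \<beta> ^ N)"
proof (induction N)
  case (Suc N)
  show ?case unfolding replicate_Suc word_val.simps Suc.IH using assms by (simp add: field_simps)
qed simp

lemma word_val_le:
  assumes "\<beta> > 1" "set w \<subseteq> {..n}"
  shows "word_val \<beta> w \<le> real n / (\<beta> - 1)"
  using assms(2)
proof (induction w)
  case (Cons k w)
  have "word_val \<beta> (k # w) \<le> (real n + real n / (\<beta> - 1)) / \<beta>"
    using Cons assms by (auto intro!: divide_right_mono add_mono)
  also have "\<dots> = real n / (\<beta> - 1)" using assms by (simp add: field_simps)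
  finally show ?case .
qed (use assms in simp)

section \<open>Counting words whose value lies in a short interval\<close>

definition hits :: "real \<Rightarrow> nat \<Rightarrow> nat \<Rightarrow> real \<Rightarrow> real \<Rightarrow> real" where
  "hits \<beta> n N b t = (\<Sum>w\<in>words n N. of_bool (b \<le> word_val \<beta> w \<and> word_val \<beta> w < b + t))"

lemma hits_le: "hits \<beta> n N b t \<le> real (n + 1) ^ N"
proof -
  have "hits \<beta> n N b t \<le> (\<Sum>w\<in>words n N. 1)" unfolding hits_def by (intro sum_mono) auto
  then show ?thesis by (simp add: card_words)
qed

lemma hits_mono: "t \<le> t' \<Longrightarrow> hits \<beta> n N b t \<le> hits \<beta> n N b t'"
  unfolding hits_def by (intro sum_mono) (auto simp: of_bool_def)

text \<open>Removing a prefix \<open>u\<close> of length \<open>K\<close> shifts the window by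
  \<open>word_val \<beta> u\<close> and magnifies it by \<open>\<beta> ^ K\<close>.\<close>

lemma hits_add:
  assumes "\<beta> > 0"
  shows "hits \<beta> n (K + N) b t = (\<Sum>u\<in>words n K. hits \<beta> n N (\<beta> ^ K * (b - word_val \<beta> u)) (\<beta> ^ K * t))"
  unfolding hits_def sum_words_add
proof (intro sum.cong refl)
  fix u w assume u: "u \<in> words n K"
  have "x / \<beta> ^ K \<ge> y \<longleftrightarrow> x \<ge> \<beta> ^ K * y" "x / \<beta> ^ K < y \<longleftrightarrow> x < \<beta> ^ K * y" for x y
    using assms by (simp_all add: field_simps)
  from this[of "b - word_val \<beta> u" "word_val \<beta> w"] this[of "word_val \<beta> w" "b - word_val \<beta> u + t"]
    this[of "word_val \<beta> w" "b - word_val \<beta> u"]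
  show "of_bool (b \<le> word_val \<beta> (u @ w) \<and> word_val \<beta> (u @ w) < b + t) =
      (of_bool (\<beta> ^ K * (b - word_val \<beta> u) \<le> word_val \<beta> w \<and>
        word_val \<beta> w < \<beta> ^ K * (b - word_val \<beta> u) + \<beta> ^ K * t) :: real)"
    unfolding word_val_append length_words[OF u]
    by (auto simp: of_bool_def distrib_left[symmetric])
qed

text \<open>A short interval cannot be reached both after the prefix \<open>0\<^sup>K\<close> and after the prefix \<open>n\<^sup>K\<close>,
  so every \<open>K\<close> letters lose at least one of the \<open>(n + 1)\<^sup>K\<close> prefixes.\<close>

lemma hits_contract:
  fixes \<beta> :: real
  assumes \<beta>: "\<beta> > 1" and K: "\<beta> ^ K \<ge> 4" and n: "n \<ge> 1"
    and t: "t \<le> real n / (\<beta> - 1) / 2"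
    and F: "\<And>b'. hits \<beta> n N b' (\<beta> ^ K * t) \<le> F"
  shows "hits \<beta> n (K + N) b t \<le> (real (n + 1) ^ K - 1) * F"
proof -
  define U where "U = real n / (\<beta> - 1)"
  have U: "U > 0" using \<beta> n by (simp add: U_def)
  define h where "h u = hits \<beta> n N (\<beta> ^ K * (b - word_val \<beta> u)) (\<beta> ^ K * t)" for u
  have h_le: "h u \<le> F" for u by (simp add: h_def F)
  have "\<exists>u\<in>words n K. h u = 0"
  \<comment> \<open>Values after \<open>K\<close> zeros are at most \<open>U / \<beta> ^ K\<close>,
    hence below \<open>b\<close> in the first case. In the second case
    \<open>b + t \<le> U / 4 + U / 2\<close>, while values after \<open>K\<close> letters
    \<open>n\<close> are at least \<open>U * (1 - 1 / \<beta> ^ K) \<ge> 3 * U / 4\<close>; equality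
    is harmless since the window is open on the right.\<close>
  proof (cases "\<beta> ^ K * b > U")
    case True
    have "h (replicate K 0) = 0" unfolding h_def hits_def
    proof (intro sum.neutral ballI)
      fix w assume "w \<in> words n N"
      then have "word_val \<beta> w \<le> U" unfolding U_def using \<beta> by (intro word_val_le) (auto simp: words_def)
      then show "of_bool (\<beta> ^ K * (b - word_val \<beta> (replicate K 0)) \<le> word_val \<beta> w \<and>
          word_val \<beta> w < \<beta> ^ K * (b - word_val \<beta> (replicate K 0)) + \<beta> ^ K * t) = (0::real)"
        using True by simp
    qed
    then show ?thesis using replicate_words[of 0 n K] by blast
  next
    case False
    have v: "word_val \<beta> (replicate K n) = U * (1 - 1 / \<beta> ^ K)"
      using word_val_replicate[OF \<beta>] by (simp add: U_def)
    have "\<beta> ^ K * t \<le> \<beta> ^ K * (U / 2)" using t \<beta> by (intro mult_left_mono) (auto simp: U_def)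
    moreover have "U * 4 \<le> U * \<beta> ^ K" using K U by (intro mult_left_mono) auto
    moreover have "\<beta> ^ K * (b - word_val \<beta> (replicate K n)) = \<beta> ^ K * b - (U * \<beta> ^ K - U)"
      unfolding v using \<beta> by (simp add: field_simps)
    moreover have "\<beta> ^ K * (U / 2) = U * \<beta> ^ K / 2" by simp
    ultimately have "\<beta> ^ K * (b - word_val \<beta> (replicate K n)) + \<beta> ^ K * t \<le> 0"
      using False by linarith
    then have "h (replicate K n) = 0" unfolding h_def hits_def
      using word_val_nonneg[of \<beta>] \<beta>
      by (intro sum.neutral ballI) (smt (verit) of_bool_eq(1))
    then show ?thesis using replicate_words[of n n K] by blast
  qed
  then obtain u where u: "u \<in> words n K" "h u = 0" by blast
  have "hits \<beta> n (K + N) b t = (\<Sum>u\<in>words n K. h u)" using hits_add \<beta> by (simp add: h_def)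
  also have "\<dots> = (\<Sum>u\<in>words n K - {u}. h u)" using u by (subst sum.remove[of _ u]) auto
  also have "\<dots> \<le> (\<Sum>u\<in>words n K - {u}. F)" by (intro sum_mono h_le)
  also have "\<dots> = (real (n + 1) ^ K - 1) * F"
    using u by (simp add: card_Diff_singleton card_words of_nat_diff)
  finally show ?thesis .
qed

text \<open>Iterating \<open>hits_contract\<close> loses a factor
  \<open>\<theta> = 1 - 1 / (n + 1) ^ K\<close> per block of \<open>K\<close> letters, that is
  \<open>\<rho> = root K \<theta>\<close> per letter. The window has the length of the range of
  values \<open>word_val \<beta> w + y / \<beta> ^ N\<close> with \<open>y\<close> in
  \<open>[0, U]\<close>.\<close>

lemma hits_bound:
  fixes \<beta> :: real
  assumes \<beta>: "\<beta> > 1" and n: "n \<ge> 1"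
  shows "\<exists>C \<rho>. 0 < \<rho> \<and> \<rho> < 1 \<and>
    (\<forall>N b. hits \<beta> n N b (real n / (\<beta> - 1) / \<beta> ^ N) \<le> C * \<rho> ^ N * real (n + 1) ^ N)"
proof -
  obtain K where K: "\<beta> ^ K > 4" using real_arch_pow[OF \<beta>] by blast
  then have K0: "K > 0" by (cases K) auto
  define \<theta> where "\<theta> = 1 - 1 / real (n + 1) ^ K"
  have "real (n + 1) ^ K > 1" using n K0 by (intro one_less_power) auto
  then have \<theta>: "0 < \<theta>" "\<theta> < 1" by (simp_all add: \<theta>_def)
  define \<rho> where "\<rho> = root K \<theta>"
  have \<rho>: "0 < \<rho>" "\<rho> < 1" "\<rho> ^ K = \<theta>" using \<theta> K0 by (simp_all add: \<rho>_def)
  define U where "U = real n / (\<beta> - 1)"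
  have U: "U > 0" using \<beta> n by (simp add: U_def)
  have "hits \<beta> n N b (U / \<beta> ^ N) \<le> 1 / \<theta> * \<rho> ^ N * real (n + 1) ^ N" for N b
  proof (induction N arbitrary: b rule: less_induct)
    case (less N)
    show ?case
    proof (cases "N < K")
      case True
      \<comment> \<open>The constant \<open>1 / \<theta>\<close> absorbs the incomplete block: for
        \<open>N < K\<close> the claimed bound is no stronger than the trivial one.\<close>
      then have "\<theta> \<le> \<rho> ^ N" unfolding \<rho>(3)[symmetric] using \<rho> by (intro power_decreasing) auto
      then have "1 \<le> 1 / \<theta> * \<rho> ^ N" using \<theta> by simp
      then have "1 * real (n + 1) ^ N \<le> 1 / \<theta> * \<rho> ^ N * real (n + 1) ^ N"
        by (intro mult_right_mono) auto
      then show ?thesis using hits_le[of \<beta> n N b "U / \<beta> ^ N"] by simp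
    next
      case False
      then obtain M where M: "N = K + M" by (metis le_Suc_ex not_less)
      have "\<beta> ^ K * 1 \<le> \<beta> ^ N" unfolding M power_add using \<beta> by (intro mult_left_mono one_le_power) auto
      then have t: "U / \<beta> ^ N \<le> U / 2" using K U by (intro divide_left_mono) auto
      have sc: "\<beta> ^ K * (U / \<beta> ^ N) = U / \<beta> ^ M" using \<beta> by (simp add: M power_add)
      have "hits \<beta> n N b (U / \<beta> ^ N) \<le> (real (n + 1) ^ K - 1) * (1 / \<theta> * \<rho> ^ M * real (n + 1) ^ M)"
        unfolding M using K t K0 less.IH[of M] sc
        by (intro hits_contract[OF \<beta> _ n]) (simp_all only: M U_def[symmetric] less_imp_le less_add_same_cancel2)
      also have "real (n + 1) ^ K - 1 = \<rho> ^ K * real (n + 1) ^ K"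
        by (simp add: \<rho>(3) \<theta>_def left_diff_distrib)
      also have "\<rho> ^ K * real (n + 1) ^ K * (1 / \<theta> * \<rho> ^ M * real (n + 1) ^ M)
        = 1 / \<theta> * \<rho> ^ N * real (n + 1) ^ N" by (simp add: M power_add)
      finally show ?thesis .
    qed
  qed
  then show ?thesis using \<rho>(1,2) unfolding U_def by blast
qed

text \<open>\<open>unsplit \<beta> B L w\<close> says that for no suffix \<open>s\<close> of \<open>w\<close> the cylinder points with tail in \<open>(0, L]\<close>,
  which fill \<open>(word_val \<beta> s, word_val \<beta> s + L / \<beta> ^ |s|]\<close>, are separated by a point of \<open>B\<close>.
  Tail \<open>0\<close> is left out because \<open>word_val \<beta> s\<close> itself may be a point of \<open>B\<close>, however small \<open>L\<close> is.\<close>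

primrec unsplit :: "real \<Rightarrow> real set \<Rightarrow> real \<Rightarrow> nat list \<Rightarrow> bool" where
  "unsplit \<beta> B L [] \<longleftrightarrow> True"
| "unsplit \<beta> B L (k # w) \<longleftrightarrow> unsplit \<beta> B L w \<and>
    (\<forall>b\<in>B. \<not> (0 < b - word_val \<beta> (k # w) \<and> b - word_val \<beta> (k # w) \<le> L / \<beta> ^ length (k # w)))"

text \<open>A union bound over the suffixes. Those of length \<open>r\<close> are equidistributed in
  \<open>words n r\<close>, so \<open>hits_bound\<close> makes the proportion of failures at length
  \<open>r\<close> at most \<open>C' * \<rho> ^ r\<close>, uniformly in \<open>m\<close>. The
  geometric tail beyond some \<open>R\<close> is small for every \<open>N\<close>, and the finitely
  many shorter words cause no failure once \<open>m\<close> is large.\<close>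

lemma few_split_words:
  fixes \<beta> :: real
  assumes \<beta>: "\<beta> > 1" and n: "n \<ge> 1" and B: "finite B" and \<epsilon>: "\<epsilon> > 0"
  shows "\<forall>\<^sub>F m in sequentially. \<forall>N.
    real (card {w \<in> words n N. \<not> unsplit \<beta> B (real n / (\<beta> - 1) / \<beta> ^ m) w}) \<le> \<epsilon> * real (n + 1) ^ N"
proof -
  define U where "U = real n / (\<beta> - 1)"
  have U: "U > 0" using \<beta> n by (simp add: U_def)
  define strad where "strad m w \<longleftrightarrow>
    (\<exists>b\<in>B. 0 < b - word_val \<beta> w \<and> b - word_val \<beta> w \<le> U / \<beta> ^ m / \<beta> ^ length w)" for m w
  \<comment> \<open>\<open>s m r\<close> is the proportion of words failing the condition at the
    full word, \<open>bad m N\<close> of those failing it at some suffix.\<close>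
  define s where "s m r = (\<Sum>w\<in>words n r. of_bool (strad m w)) / real (n + 1) ^ r" for m r
  define bad where "bad m N = (\<Sum>w\<in>words n N. of_bool (\<not> unsplit \<beta> B (U / \<beta> ^ m) w)) / real (n + 1) ^ N" for m N
  obtain C \<rho> where \<rho>: "0 < \<rho>" "\<rho> < 1"
      and C: "\<And>N b. hits \<beta> n N b (U / \<beta> ^ N) \<le> C * \<rho> ^ N * real (n + 1) ^ N"
    using hits_bound[OF \<beta> n] unfolding U_def by blast
  define C' where "C' = real (card B) * C"
  have s_le: "s m r \<le> C' * \<rho> ^ r" for m r
  proof -
    define t where "t = U / \<beta> ^ m / \<beta> ^ r"
    have t: "t \<le> U / \<beta> ^ r" unfolding t_def using U \<beta>
      by (intro divide_right_mono) (simp_all add: divide_le_eq one_le_power)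
    \<comment> \<open>The condition \<open>0 < b - word_val \<beta> w \<le> t\<close> puts the value
      into \<open>[b - t, b)\<close>, a half-open window as counted by \<open>hits\<close>.\<close>
    have "(\<Sum>w\<in>words n r. of_bool (strad m w)) \<le>
        (\<Sum>w\<in>words n r. \<Sum>b\<in>B. of_bool (b - t \<le> word_val \<beta> w \<and> word_val \<beta> w < b - t + t) :: real)"
    proof (intro sum_mono)
      fix w assume w: "w \<in> words n r"
      show "of_bool (strad m w) \<le>
        (\<Sum>b\<in>B. of_bool (b - t \<le> word_val \<beta> w \<and> word_val \<beta> w < b - t + t) :: real)"
      proof (cases "strad m w")
        case True
        then obtain b where "b \<in> B" "0 < b - word_val \<beta> w" "b - word_val \<beta> w \<le> t"
          by (auto simp: strad_def t_def length_words[OF w])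
        then show ?thesis using B member_le_sum[of b B "\<lambda>b. of_bool (b - t \<le> word_val \<beta> w \<and> word_val \<beta> w < b - t + t) :: real"]
          by (simp add: True)
      qed (simp add: sum_nonneg)
    qed
    also have "\<dots> = (\<Sum>b\<in>B. hits \<beta> n r (b - t) t)" unfolding hits_def by (rule sum.swap)
    also have "\<dots> \<le> (\<Sum>b\<in>B. C * \<rho> ^ r * real (n + 1) ^ r)"
      by (intro sum_mono order_trans[OF hits_mono[OF t] C])
    finally show ?thesis by (simp add: s_def C'_def divide_le_eq mult.assoc)
  qed
  have s_nonneg: "s m r \<ge> 0" for m r unfolding s_def by (intro divide_nonneg_nonneg sum_nonneg) auto
  have bad_le: "bad m N \<le> (\<Sum>r\<le>N. s m r)" for m N
  proof (induction N)
    case 0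
    then show ?case using s_nonneg[of m 0] by (simp add: bad_def)
  next
    case (Suc N)
    \<comment> \<open>The nonempty suffixes of \<open>k # w\<close> are those of \<open>w\<close>
      and \<open>k # w\<close> itself; averaging over \<open>k\<close> turns the first group back
      into \<open>bad m N\<close>.\<close>
    have "(\<Sum>w\<in>words n (Suc N). of_bool (\<not> unsplit \<beta> B (U / \<beta> ^ m) w) :: real)
      \<le> (\<Sum>k\<le>n. \<Sum>w\<in>words n N. of_bool (\<not> unsplit \<beta> B (U / \<beta> ^ m) w) + of_bool (strad m (k # w)))"
      unfolding sum_words_Suc by (intro sum_mono) (auto simp: strad_def of_bool_def)
    also have "\<dots> = real (n + 1) * (\<Sum>w\<in>words n N. of_bool (\<not> unsplit \<beta> B (U / \<beta> ^ m) w))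
        + (\<Sum>w\<in>words n (Suc N). of_bool (strad m w))"
      by (simp add: sum.distrib sum_words_Suc)
    finally have "bad m (Suc N) \<le> (real (n + 1) * (\<Sum>w\<in>words n N. of_bool (\<not> unsplit \<beta> B (U / \<beta> ^ m) w))
        + (\<Sum>w\<in>words n (Suc N). of_bool (strad m w))) / real (n + 1) ^ Suc N"
      unfolding bad_def by (intro divide_right_mono) auto
    also have "\<dots> = bad m N + s m (Suc N)"
      unfolding bad_def s_def add_divide_distrib by simp
    finally show ?case using Suc by simp
  qed
  have "(\<lambda>R. C' * \<rho> ^ R / (1 - \<rho>)) \<longlonglongrightarrow> C' * 0 / (1 - \<rho>)"
    using \<rho> by (intro tendsto_intros) auto
  then have "\<forall>\<^sub>F R in sequentially. C' * \<rho> ^ R / (1 - \<rho>) < \<epsilon>"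
    using \<epsilon> by (intro order_tendstoD) auto
  then obtain R where R: "C' * \<rho> ^ R / (1 - \<rho>) < \<epsilon>" unfolding eventually_sequentially by blast
  have tail: "(\<Sum>r\<in>{R..N}. s m r) \<le> \<epsilon>" for m N
  proof -
    have "(\<Sum>r\<in>{R..N}. \<rho> ^ r) \<le> \<rho> ^ R / (1 - \<rho>)"
      using \<rho> by (auto simp: sum_gp intro!: divide_right_mono)
    moreover have "C' \<ge> 0" using s_le[of 0 0] s_nonneg[of 0 0] by simp
    moreover have "(\<Sum>r\<in>{R..N}. s m r) \<le> C' * (\<Sum>r\<in>{R..N}. \<rho> ^ r)"
      unfolding sum_distrib_left by (intro sum_mono s_le)
    ultimately have "(\<Sum>r\<in>{R..N}. s m r) \<le> C' * (\<rho> ^ R / (1 - \<rho>))"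
      by (meson mult_left_mono order_trans)
    then show ?thesis using R by simp
  qed
  \<comment> \<open>Each strictly positive distance is eventually larger than the shrinking
    interval; a zero distance is harmless because tail 0 is left out of
    \<open>unsplit\<close>.\<close>
  have "\<forall>\<^sub>F m in sequentially. \<forall>r\<in>{..<R}. \<forall>w\<in>words n r. \<forall>b\<in>B.
      \<not> (0 < b - word_val \<beta> w \<and> b - word_val \<beta> w \<le> U / \<beta> ^ m / \<beta> ^ length w)"
  proof (intro eventually_ball_finite finite_words finite_lessThan B ballI)
    fix r w b
    show "\<forall>\<^sub>F m in sequentially. \<not> (0 < b - word_val \<beta> w \<and> b - word_val \<beta> w \<le> U / \<beta> ^ m / \<beta> ^ length w)"
    proof (cases "0 < b - word_val \<beta> w")
      case True
      have "(\<lambda>m. U * (1 / \<beta>) ^ m / \<beta> ^ length w) \<longlonglongrightarrow> U * 0 / \<beta> ^ length w"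
        using \<beta> by (intro tendsto_intros) auto
      then have "\<forall>\<^sub>F m in sequentially. U * (1 / \<beta>) ^ m / \<beta> ^ length w < b - word_val \<beta> w"
        using True by (intro order_tendstoD) auto
      then show ?thesis by eventually_elim (simp add: power_divide)
    qed simp
  qed
  then show ?thesis
  proof eventually_elim
    case (elim m)
    have zero: "s m r = 0" if "r < R" for r
      using elim that by (force simp: s_def strad_def)
    have "bad m N \<le> \<epsilon>" for N
    proof -
      have "(\<Sum>r\<le>N. s m r) = (\<Sum>r\<in>{R..N}. s m r)"
        using zero by (intro sum.mono_neutral_right) auto
      then show ?thesis using bad_le[of m N] tail[of m N] by simp
    qed
    moreover have "bad m N = real (card {w \<in> words n N. \<not> unsplit \<beta> B (U / \<beta> ^ m) w}) / real (n + 1) ^ N" for N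
      by (simp add: bad_def of_bool_def sum.If_cases Int_def)
    ultimately show ?case by (simp add: divide_le_eq U_def)
  qed
qed

section \<open>Cylinders of the random beta-transformation\<close>

primrec starts :: "real \<Rightarrow> nat list \<Rightarrow> (nat \<Rightarrow> bool) \<times> real \<Rightarrow> bool" where
  "starts \<beta> [] z \<longleftrightarrow> True"
| "starts \<beta> (k # w) z \<longleftrightarrow> d1 \<beta> z = k \<and> starts \<beta> w (K_beta \<beta> z)"

lemma starts_append: "starts \<beta> (u @ v) z \<longleftrightarrow> starts \<beta> u z \<and> starts \<beta> v ((K_beta \<beta> ^^ length u) z)"
  by (induction u arbitrary: z) (auto simp: funpow_swap1)

lemma starts_iff_digits: "starts \<beta> w z \<longleftrightarrow> (\<forall>i<length w. digits \<beta> z i = w ! i)"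
proof (induction w arbitrary: z)
  case (Cons k w)
  have "digits \<beta> z (Suc i) = digits \<beta> (K_beta \<beta> z) i" for i
    by (simp add: digits_def funpow_swap1)
  moreover have "digits \<beta> z 0 = d1 \<beta> z" by (simp add: digits_def)
  ultimately show ?case using Cons by (simp add: All_less_Suc2)
qed simp

lemma snd_K_beta: "snd (K_beta \<beta> z) = \<beta> * snd z - real (d1 \<beta> z)"
  by (simp add: K_beta_def split: prod.splits)

locale random_beta =
  fixes \<beta> :: real
  assumes gt1: "\<beta> > 1" and nonint: "\<beta> \<notin> \<int>"
begin

section \<open>Regions and digits in the coordinate \<open>\<beta> * x\<close>\<close>

definition n :: nat where "n = maxdigit \<beta>"
definition U :: real where "U = real n / (\<beta> - 1)"

lemma n_bounds: "1 \<le> n" "real n < \<beta>" "\<beta> < real n + 1"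
proof -
  have 1: "\<lfloor>\<beta>\<rfloor> \<ge> 1" using gt1 by linarith
  then have 2: "real n = of_int \<lfloor>\<beta>\<rfloor>" by (simp add: n_def maxdigit_def)
  have "of_int \<lfloor>\<beta>\<rfloor> \<noteq> \<beta>" using nonint by (metis Ints_of_int)
  then show "1 \<le> n" "real n < \<beta>" "\<beta> < real n + 1" using 1 2 by linarith+
qed

lemma U_eq: "\<beta> * U = U + real n"
  using gt1 by (simp add: U_def field_simps)

lemma U_gt1: "U > 1"
  using gt1 n_bounds by (simp add: U_def)

text \<open>From \<open>\<beta> > n\<close> follows \<open>U < n / (n - 1) \<le> 2\<close>, which
  keeps neighbouring switch regions disjoint; for \<open>n = 1\<close> there is only one.\<close>

lemma U_lt2: "n \<ge> 2 \<Longrightarrow> U < 2"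
  using gt1 n_bounds by (simp add: U_def field_simps)

lemma J_iff: "x \<in> J_beta \<beta> \<longleftrightarrow> 0 \<le> x \<and> x \<le> U"
  by (simp add: J_beta_def U_def n_def)

lemma upper_eq:
  "real (maxdigit \<beta>) / (\<beta> * (\<beta> - 1)) + (real k - 1) / \<beta> = (U + real k - 1) / \<beta>"
  using gt1 by (simp add: U_def n_def field_simps)

text \<open>These are exactly the points for which both digits \<open>k - 1\<close> and
  \<open>k\<close> leave a remainder in \<open>[0, U]\<close>.\<close>

lemma switch_iff: "x \<in> switch \<beta> k \<longleftrightarrow> real k \<le> \<beta> * x \<and> \<beta> * x \<le> U + real k - 1"
  unfolding switch_def upper_eq using gt1 by (auto simp: field_simps)

lemma switch_region_iff: "x \<in> switch_region \<beta> \<longleftrightarrow> (\<exists>k\<in>{1..n}. x \<in> switch \<beta> k)"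
  by (auto simp: switch_region_def n_def)

lemma equality_iff:
  "x \<in> equality \<beta> k \<longleftrightarrow>
    (if k = 0 then 0 \<le> x \<and> \<beta> * x < 1
     else if k = n then U + real n - 1 < \<beta> * x \<and> x \<le> U
     else U + real k - 1 < \<beta> * x \<and> \<beta> * x < real k + 1)"
proof -
  have U: "real n / (\<beta> - 1) = U" by (simp add: U_def)
  show ?thesis
    unfolding equality_def upper_eq unfolding n_def[symmetric] U
    using gt1 by (auto simp: field_simps)
qed

lemma switch_unique:
  assumes "x \<in> switch \<beta> k" "k \<in> {1..n}" "x \<in> switch \<beta> j" "j \<in> {1..n}"
  shows "k = j"
proof -
  have False if "x \<in> switch \<beta> k" "k \<in> {1..n}" "x \<in> switch \<beta> j" "j \<in> {1..n}" "k < j" for k j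
  proof -
    have "n \<ge> 2" "real k + 1 \<le> real j" using that by auto
    then show False using U_lt2 that by (auto simp: switch_iff)
  qed
  then show ?thesis using assms by (metis linorder_neqE_nat)
qed

lemma equality_bounds:
  assumes "x \<in> equality \<beta> k"
  shows "real k \<le> \<beta> * x" "\<beta> * x \<le> U + real k"
proof -
  have "k = n \<Longrightarrow> \<beta> * x \<le> \<beta> * U" "0 \<le> x \<Longrightarrow> 0 \<le> \<beta> * x"
    using assms gt1 n_bounds by (auto simp: equality_iff split: if_splits)
  then show "real k \<le> \<beta> * x" "\<beta> * x \<le> U + real k"
    using assms U_gt1 by (auto simp: equality_iff U_eq split: if_splits)
qed

lemma equality_unique:
  assumes "x \<in> equality \<beta> k" "k \<le> n" "x \<in> equality \<beta> j" "j \<le> n"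
  shows "k = j"
proof -
  have False if "x \<in> equality \<beta> k" "k \<le> n" "x \<in> equality \<beta> j" "j \<le> n" "k < j" for k j
  proof -
    have "real k + 1 \<le> real j" "k \<noteq> n" using that by auto
    then show False using that U_gt1 by (auto simp: equality_iff split: if_splits)
  qed
  then show ?thesis using assms by (metis linorder_neqE_nat)
qed

lemma equality_exists:
  assumes x: "x \<in> J_beta \<beta>" "x \<notin> switch_region \<beta>"
  shows "\<exists>k\<le>n. x \<in> equality \<beta> k"
proof -
  have x0: "0 \<le> \<beta> * x" using x gt1 by (simp add: J_iff)
  \<comment> \<open>The greedy digit, capped at \<open>n\<close> because \<open>\<beta> * x\<close>
    can reach \<open>U + n > n + 1\<close>.\<close>
  define k where "k = min n (nat \<lfloor>\<beta> * x\<rfloor>)"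
  have k: "k \<le> n" "real k \<le> \<beta> * x" "k \<noteq> n \<Longrightarrow> \<beta> * x < real k + 1"
    using x0 unfolding k_def min_def by (auto simp: of_nat_nat) linarith+
  have "k \<noteq> 0 \<Longrightarrow> U + real k - 1 < \<beta> * x"
    using x(2) k by (force simp: switch_region_iff switch_iff)
  then have "x \<in> equality \<beta> k"
    using k x n_bounds by (auto simp: equality_iff J_iff)
  then show ?thesis using k by blast
qed

lemma d1_switch:
  assumes "x \<in> switch \<beta> k" "k \<in> {1..n}"
  shows "d1 \<beta> (\<omega>, x) = (if \<omega> 0 then k else k - 1)"
proof -
  have "x \<in> switch_region \<beta>" using assms by (auto simp: switch_region_iff)
  moreover have "(THE k. k \<in> {1..maxdigit \<beta>} \<and> x \<in> switch \<beta> k) = k"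
    using assms switch_unique by (intro the_equality) (auto simp: n_def)
  ultimately show ?thesis unfolding d1_def by (simp add: Let_def)
qed

lemma d1_equality:
  assumes "x \<in> equality \<beta> k" "k \<le> n" "x \<notin> switch_region \<beta>"
  shows "d1 \<beta> (\<omega>, x) = k"
proof -
  have "(THE k. k \<in> {0..maxdigit \<beta>} \<and> x \<in> equality \<beta> k) = k"
    using assms equality_unique by (intro the_equality) (auto simp: n_def)
  then show ?thesis using assms unfolding d1_def by simp
qed

lemma d1_admissible:
  assumes x: "x \<in> J_beta \<beta>"
  shows "d1 \<beta> (\<omega>, x) \<le> n \<and> \<beta> * x - real (d1 \<beta> (\<omega>, x)) \<in> J_beta \<beta>"
proof (cases "x \<in> switch_region \<beta>")
  case True
  then obtain k where k: "k \<in> {1..n}" "x \<in> switch \<beta> k" by (auto simp: switch_region_iff)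
  then show ?thesis
    unfolding d1_switch[OF k(2,1)] by (auto simp: J_iff switch_iff of_nat_diff)
next
  case False
  then obtain k where k: "k \<le> n" "x \<in> equality \<beta> k" using equality_exists x by blast
  then show ?thesis
    using equality_bounds[OF k(2)] by (simp add: d1_equality[OF k(2,1) False] J_iff)
qed

lemma K_beta_in_J: "snd z \<in> J_beta \<beta> \<Longrightarrow> snd (K_beta \<beta> z) \<in> J_beta \<beta>"
  using d1_admissible[of "snd z" "fst z"] by (simp add: snd_K_beta)

section \<open>Zero digits, boundary points and contraction of cylinders\<close>

lemma d1_near_0:
  assumes "0 \<le> x" "\<beta> * x < 1"
  shows "x \<notin> switch_region \<beta>" "d1 \<beta> (\<omega>, x) = 0"
proof -
  show S: "x \<notin> switch_region \<beta>" using assms by (auto simp: switch_region_iff switch_iff)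
  have "x \<in> equality \<beta> 0" using assms by (simp add: equality_iff)
  then show "d1 \<beta> (\<omega>, x) = 0" using S by (intro d1_equality) auto
qed

text \<open>For a tail below 1, prepending the digit 0 is division by \<open>\<beta>\<close> and
  uses no coin. This is what makes one further zero act as a pure contraction.\<close>

lemma K_beta_near_0:
  assumes "0 \<le> y" "y < 1"
  shows "d1 \<beta> (\<omega>, y / \<beta>) = 0" "K_beta \<beta> (\<omega>, y / \<beta>) = (\<omega>, y)"
proof -
  have "0 \<le> y / \<beta>" "\<beta> * (y / \<beta>) = y" using assms gt1 by auto
  then have "y / \<beta> \<notin> switch_region \<beta>" "d1 \<beta> (\<omega>, y / \<beta>) = 0"
    using d1_near_0[of "y / \<beta>"] assms by auto
  then show "d1 \<beta> (\<omega>, y / \<beta>) = 0" "K_beta \<beta> (\<omega>, y / \<beta>) = (\<omega>, y)"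
    using gt1 by (auto simp: K_beta_def)
qed

text \<open>The end points of the switch regions; apart from the ends \<open>0\<close> and
  \<open>U\<close> of \<open>J_beta \<beta>\<close> they are also those of the equality
  regions.\<close>

definition bounds :: "real set" where
  "bounds = (\<lambda>k. real k / \<beta>) ` {1..n} \<union> (\<lambda>k. (U + real k - 1) / \<beta>) ` {1..n}"

lemma finite_bounds: "finite bounds"
  by (simp add: bounds_def)

text \<open>Membership in each region is a system of comparisons with end points. Both directions
  are compared since open and closed ends occur.\<close>

lemma d1_cong:
  assumes J: "x \<in> J_beta \<beta>" "x' \<in> J_beta \<beta>"
    and B: "\<And>b. b \<in> bounds \<Longrightarrow> (b \<le> x \<longleftrightarrow> b \<le> x') \<and> (x \<le> b \<longleftrightarrow> x' \<le> b)"
  shows "x \<in> switch_region \<beta> \<longleftrightarrow> x' \<in> switch_region \<beta>" "d1 \<beta> (\<omega>, x) = d1 \<beta> (\<omega>, x')"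
proof -
  have lo: "real k \<le> \<beta> * x \<longleftrightarrow> real k \<le> \<beta> * x'"
    and up: "\<beta> * x \<le> U + real k - 1 \<longleftrightarrow> \<beta> * x' \<le> U + real k - 1" if "k \<in> {1..n}" for k
    using B[of "real k / \<beta>"] B[of "(U + real k - 1) / \<beta>"] that gt1
    by (auto simp: bounds_def field_simps)
  have sw: "x \<in> switch \<beta> k \<longleftrightarrow> x' \<in> switch \<beta> k" if "k \<in> {1..n}" for k
    using lo up that by (simp add: switch_iff)
  then show S: "x \<in> switch_region \<beta> \<longleftrightarrow> x' \<in> switch_region \<beta>" by (auto simp: switch_region_iff)
  \<comment> \<open>The equality region \<open>k\<close> begins where switch region \<open>k\<close>
    ends, and ends where switch region \<open>Suc k\<close> begins.\<close>
  have eq: "x \<in> equality \<beta> k \<longleftrightarrow> x' \<in> equality \<beta> k" if "k \<le> n" for k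
    using lo[of "Suc k"] up[of k] that J n_bounds by (auto simp: equality_iff J_iff)
  show "d1 \<beta> (\<omega>, x) = d1 \<beta> (\<omega>, x')"
    using S sw eq unfolding d1_def by (simp add: n_def[symmetric] cong: conj_cong)
qed

text \<open>\<open>(k + x) / \<beta>\<close> stays in \<open>[0, U]\<close> for
  \<open>k \<le> n\<close>, because \<open>\<beta> * U = U + n\<close>.\<close>

lemma word_in_J:
  assumes "set w \<subseteq> {..n}" "0 \<le> y" "y \<le> U"
  shows "word_val \<beta> w + y / \<beta> ^ length w \<in> J_beta \<beta>"
  using assms
proof (induction w)
  case (Cons k w)
  define x where "x = word_val \<beta> w + y / \<beta> ^ length w"
  have "0 \<le> x" "x \<le> U" "real k \<le> real n" using Cons by (auto simp: x_def J_iff)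
  then have "0 \<le> real k + x" "real k + x \<le> \<beta> * U" by (auto simp: U_eq)
  moreover have "word_val \<beta> (k # w) + y / \<beta> ^ length (k # w) = (real k + x) / \<beta>"
    using gt1 by (simp add: x_def field_simps)
  ultimately show ?case using gt1 by (simp only: J_iff) (simp add: divide_le_eq mult.commute)
qed (simp add: J_iff)

text \<open>Solves \<open>x' = \<beta> * x - k\<close> for \<open>x\<close> along the word;
  \<open>y\<close> is the second coordinate reached after \<open>length w\<close> steps.\<close>

lemma starts_point:
  assumes "snd z \<in> J_beta \<beta>" "starts \<beta> w z"
  shows "set w \<subseteq> {..n} \<and> (\<exists>y. 0 \<le> y \<and> y \<le> U \<and> snd z = word_val \<beta> w + y / \<beta> ^ length w)"
  using assms
proof (induction w arbitrary: z)
  case (Cons k w)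
  then have k: "k = d1 \<beta> z" "k \<le> n" using d1_admissible[of "snd z" "fst z"] by auto
  obtain y where y: "set w \<subseteq> {..n}" "0 \<le> y" "y \<le> U" "snd (K_beta \<beta> z) = word_val \<beta> w + y / \<beta> ^ length w"
    using Cons.IH[of "K_beta \<beta> z"] Cons.prems K_beta_in_J by auto
  then have "snd z = word_val \<beta> (k # w) + y / \<beta> ^ length (k # w)"
    using gt1 by (simp add: snd_K_beta k(1)[symmetric] field_simps)
  then show ?case using y k by auto
qed (auto simp: J_iff)

text \<open>With the coins fixed, all points of an unsplit cylinder see the same switch regions.\<close>

lemma starts_unsplit:
  assumes "unsplit \<beta> bounds L w" "set w \<subseteq> {..n}" "L \<le> U"
    and "0 < y" "y \<le> L" "0 < y'" "y' \<le> L"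
    and "starts \<beta> w (\<omega>, word_val \<beta> w + y / \<beta> ^ length w)"
  shows "starts \<beta> w (\<omega>, word_val \<beta> w + y' / \<beta> ^ length w) \<and>
    (\<exists>\<omega>'. (K_beta \<beta> ^^ length w) (\<omega>, word_val \<beta> w + y / \<beta> ^ length w) = (\<omega>', y) \<and>
      (K_beta \<beta> ^^ length w) (\<omega>, word_val \<beta> w + y' / \<beta> ^ length w) = (\<omega>', y'))"
  using assms
proof (induction w arbitrary: \<omega>)
  case (Cons k w)
  define x where "x y = word_val \<beta> (k # w) + y / \<beta> ^ length (k # w)" for y
  have J: "x y \<in> J_beta \<beta>" "x y' \<in> J_beta \<beta>"
    unfolding x_def using Cons.prems by (intro word_in_J; simp)+
  have bd: "word_val \<beta> (k # w) < x t \<and> x t \<le> word_val \<beta> (k # w) + L / \<beta> ^ length (k # w)"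
    if "0 < t" "t \<le> L" for t
    unfolding x_def using that gt1 by (simp del: word_val.simps add: divide_right_mono)
  \<comment> \<open>Both points lie in \<open>(word_val \<beta> (k # w), word_val \<beta> (k # w) +
    L / \<beta> ^ length (k # w)]\<close>, which contains no boundary point.\<close>
  have same: "(b \<le> x y \<longleftrightarrow> b \<le> x y') \<and> (x y \<le> b \<longleftrightarrow> x y' \<le> b)" if "b \<in> bounds" for b
  proof -
    have "\<not> (0 < b - word_val \<beta> (k # w) \<and> b - word_val \<beta> (k # w) \<le> L / \<beta> ^ length (k # w))"
      using Cons.prems(1) that unfolding unsplit.simps by blast
    then show ?thesis using bd[of y] bd[of y'] Cons.prems(4-7) by linarith
  qed
  note cong = d1_cong(1)[OF J same] d1_cong(2)[OF J same, of \<omega>]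
  have "d1 \<beta> (\<omega>, x y) = k" using Cons.prems(8) by (simp add: x_def)
  moreover define \<omega>1 where "\<omega>1 = (if x y \<in> switch_region \<beta> then shift \<omega> else \<omega>)"
  moreover have "\<beta> * x t - real k = word_val \<beta> w + t / \<beta> ^ length w" for t
    unfolding x_def using gt1 by (simp add: field_simps)
  ultimately have K: "d1 \<beta> (\<omega>, x y) = k" "d1 \<beta> (\<omega>, x y') = k"
      "K_beta \<beta> (\<omega>, x y) = (\<omega>1, word_val \<beta> w + y / \<beta> ^ length w)"
      "K_beta \<beta> (\<omega>, x y') = (\<omega>1, word_val \<beta> w + y' / \<beta> ^ length w)"
    using cong by (simp_all add: K_beta_def)
  have "starts \<beta> w (\<omega>1, word_val \<beta> w + y / \<beta> ^ length w)"
    using Cons.prems(8) K by (simp add: x_def)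
  then have IH: "starts \<beta> w (\<omega>1, word_val \<beta> w + y' / \<beta> ^ length w) \<and>
    (\<exists>\<omega>'. (K_beta \<beta> ^^ length w) (\<omega>1, word_val \<beta> w + y / \<beta> ^ length w) = (\<omega>', y) \<and>
      (K_beta \<beta> ^^ length w) (\<omega>1, word_val \<beta> w + y' / \<beta> ^ length w) = (\<omega>', y'))"
    using Cons.IH[of \<omega>1] Cons.prems by simp
  show ?case
    unfolding x_def[symmetric] starts.simps(2)
    unfolding length_Cons funpow_Suc_right comp_apply K using IH by simp
qed simp

text \<open>For fixed coins, the dilation by \<open>1 / \<beta>\<close> about
  \<open>word_val \<beta> u\<close> maps the cylinder of \<open>u\<close> and \<open>m\<close> zeros
  onto the one with \<open>m + 1\<close> zeros. The centre \<open>s = 0\<close> is excluded because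
  \<open>unsplit\<close> does not control tail 0; \<open>U < \<beta> ^ m\<close> brings the tails
  after \<open>u\<close> below 1.\<close>

lemma starts_contract:
  assumes u: "unsplit \<beta> bounds (U / \<beta> ^ m) u" "set u \<subseteq> {..n}" and m: "U < \<beta> ^ m" and s: "s \<noteq> 0"
  shows "word_val \<beta> u + s \<in> J_beta \<beta> \<and> starts \<beta> (u @ replicate m 0) (\<omega>, word_val \<beta> u + s) \<longleftrightarrow>
    word_val \<beta> u + s / \<beta> \<in> J_beta \<beta> \<and> starts \<beta> (u @ replicate (Suc m) 0) (\<omega>, word_val \<beta> u + s / \<beta>)"
proof -
  define L where "L = U / \<beta> ^ m"
  have pow: "\<beta> ^ m \<ge> 1" using gt1 by simp
  have L: "0 < L" "L < 1" "L \<le> U"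
    using m U_gt1 pow gt1 by (simp_all add: L_def divide_le_eq mult_le_cancel_left1)
  define N where "N = length u"
  define y where "y = s * \<beta> ^ N"
  have y: "s = y / \<beta> ^ N" "y \<noteq> 0" using s gt1 by (auto simp: y_def)
  have step: "starts \<beta> (u @ replicate m 0) (\<omega>, word_val \<beta> u + y / \<beta> ^ N) \<longleftrightarrow>
      starts \<beta> (u @ replicate (Suc m) 0) (\<omega>, word_val \<beta> u + (y / \<beta>) / \<beta> ^ N)" if yL: "0 < y" "y \<le> L"
  proof -
    have "y / \<beta> \<le> y" using yL gt1 by (simp add: divide_le_eq)
    then have yb: "0 < y / \<beta>" "y / \<beta> \<le> L" using yL gt1 by auto
    note a = starts_unsplit[OF u(1)[folded L_def] u(2) L(3) yL yb, of \<omega>, folded N_def]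
    note b = starts_unsplit[OF u(1)[folded L_def] u(2) L(3) yb yL, of \<omega>, folded N_def]
    \<comment> \<open>From \<open>y / \<beta>\<close> the first zero leads to \<open>y\<close> with
      the coins unchanged.\<close>
    have "starts \<beta> (replicate m 0) (\<omega>', y) \<longleftrightarrow> starts \<beta> (replicate (Suc m) 0) (\<omega>', y / \<beta>)" for \<omega>'
      using K_beta_near_0[of y \<omega>'] yL L by simp
    then show ?thesis using a b unfolding starts_append N_def[symmetric] by auto
  qed
  \<comment> \<open>Being followed by \<open>m\<close> zeros forces the tail after \<open>u\<close>
    to be at most \<open>U / \<beta> ^ m = L\<close>. In \<open>range'\<close> the tail is
    \<open>y / \<beta>\<close> with \<open>m + 1\<close> zeros, which bounds \<open>y\<close> by the
    same \<open>L\<close>.\<close>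
  have range: "0 < y \<and> y \<le> L" if rg: "word_val \<beta> u + y / \<beta> ^ N \<in> J_beta \<beta>"
    "starts \<beta> (u @ replicate m 0) (\<omega>, word_val \<beta> u + y / \<beta> ^ N)"
  proof -
    obtain t where "0 \<le> t" "t \<le> U" "word_val \<beta> u + y / \<beta> ^ N = word_val \<beta> u + t / \<beta> ^ (N + m)"
      using starts_point[OF _ rg(2)] rg(1) by (auto simp: word_val_append N_def)
    then have "y = t / \<beta> ^ m" "0 \<le> t" "t \<le> U" using gt1 by (auto simp: power_add field_simps)
    then show ?thesis using y(2) gt1 unfolding L_def by (auto intro!: divide_right_mono)
  qed
  have range': "0 < y \<and> y \<le> L" if rg: "word_val \<beta> u + (y / \<beta>) / \<beta> ^ N \<in> J_beta \<beta>"
    "starts \<beta> (u @ replicate (Suc m) 0) (\<omega>, word_val \<beta> u + (y / \<beta>) / \<beta> ^ N)"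
  proof -
    obtain t where "0 \<le> t" "t \<le> U" "word_val \<beta> u + (y / \<beta>) / \<beta> ^ N = word_val \<beta> u + t / \<beta> ^ (N + Suc m)"
      using starts_point[OF _ rg(2)] rg(1) by (auto simp: word_val_append N_def simp del: replicate_Suc)
    then have "y = t / \<beta> ^ m" "0 \<le> t" "t \<le> U" using gt1 by (auto simp: power_add field_simps)
    then show ?thesis using y(2) gt1 unfolding L_def by (auto intro!: divide_right_mono)
  qed
  have J: "word_val \<beta> u + t / \<beta> ^ N \<in> J_beta \<beta>" if "0 < t" "t \<le> L" for t
    unfolding N_def using u that L by (intro word_in_J) auto
  have "y / \<beta> \<le> y" if "0 < y" using that gt1 by (simp add: divide_le_eq)
  then have "0 < y \<and> y \<le> L \<Longrightarrow> 0 < y / \<beta> \<and> y / \<beta> \<le> L" using gt1 by auto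
  moreover have "s / \<beta> = (y / \<beta>) / \<beta> ^ N" by (simp add: y)
  ultimately show ?thesis using step range range' J[of y] J[of "y / \<beta>"] unfolding y(1) by metis
qed

end

section \<open>Measures of cylinders\<close>

text \<open>Change of variables for the dilation by \<open>1 / c\<close> about \<open>v\<close>; the
  centre is a null set, so nothing is assumed there.\<close>

lemma emeasure_lborel_contract:
  fixes A B :: "real set"
  assumes c: "c > 0" and [measurable]: "A \<in> sets borel" "B \<in> sets borel"
    and iff: "\<And>s. s \<noteq> 0 \<Longrightarrow> v + s \<in> A \<longleftrightarrow> v + s / c \<in> B"
  shows "emeasure lborel B = ennreal (1 / c) * emeasure lborel A"
proof -
  have "emeasure lborel B = (\<integral>\<^sup>+x. indicator B x \<partial>lborel)" by simp
  also have "\<dots> = ennreal \<bar>1 / c\<bar> * (\<integral>\<^sup>+x. indicator B ((v - v / c) + 1 / c * x) \<partial>lborel)"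
    using c by (intro nn_integral_real_affine) auto
  also have "(\<integral>\<^sup>+x. indicator B ((v - v / c) + 1 / c * x) \<partial>lborel) = (\<integral>\<^sup>+x. indicator A x \<partial>lborel)"
  proof (rule nn_integral_cong_AE)
    have eq: "(v - v / c) + 1 / c * x = v + (x - v) / c" for x by (simp add: diff_divide_distrib)
    have "AE x in lborel. x \<noteq> v" by (rule AE_lborel_singleton)
    then show "AE x in lborel. indicator B ((v - v / c) + 1 / c * x) = (indicator A x :: ennreal)"
    proof eventually_elim
      case (elim x)
      then show ?case using iff[of "x - v"] unfolding eq by (simp add: indicator_def)
    qed
  qed
  finally show ?thesis using c by simp
qed

lemma prob_space_coin_measure: "prob_space (coin_measure p)"
  unfolding coin_measure_def by (intro prob_space_PiM prob_space_measure_pmf)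

context random_beta
begin

section \<open>Measurability of the map\<close>

lemma space_phase: "space (phase_space \<beta>) = UNIV \<times> J_beta \<beta>"
  by (simp add: phase_space_def space_pair_measure space_PiM space_restrict_space)

lemma meas_coin [measurable]: "(\<lambda>z. fst z i) \<in> phase_space \<beta> \<rightarrow>\<^sub>M count_space UNIV"
  unfolding phase_space_def by measurable

lemma meas_snd [measurable]: "snd \<in> borel_measurable (phase_space \<beta>)"
proof -
  have "(\<lambda>x. x) \<in> restrict_space borel (J_beta \<beta>) \<rightarrow>\<^sub>M (borel :: real measure)"
    by (rule measurable_restrict_space1) simp
  then show ?thesis unfolding phase_space_def by (rule measurable_compose[OF measurable_snd])
qed

lemma sets_regions [measurable]: "switch \<beta> k \<in> sets borel" "equality \<beta> k \<in> sets borel"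
  "switch_region \<beta> \<in> sets borel"
proof -
  show sw: "switch \<beta> k \<in> sets borel" for k by (simp add: switch_def)
  show "equality \<beta> k \<in> sets borel" unfolding equality_def by simp
  show "switch_region \<beta> \<in> sets borel" unfolding switch_region_def by (intro sets.finite_UN sw) simp
qed

text \<open>Describes the level sets of \<open>d1\<close> without definite descriptions, so that
  \<open>meas_d1\<close> can read off their measurability.\<close>

lemma d1_eq_iff:
  assumes x: "x \<in> J_beta \<beta>"
  shows "d1 \<beta> (\<omega>, x) = k \<longleftrightarrow> (x \<notin> switch_region \<beta> \<and> k \<le> n \<and> x \<in> equality \<beta> k) \<or>
    (1 \<le> k \<and> k \<le> n \<and> x \<in> switch \<beta> k \<and> \<omega> 0) \<or>
    (Suc k \<le> n \<and> x \<in> switch \<beta> (Suc k) \<and> \<not> \<omega> 0)"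
proof (cases "x \<in> switch_region \<beta>")
  case True
  then obtain j where j: "j \<in> {1..n}" "x \<in> switch \<beta> j" by (auto simp: switch_region_iff)
  have sw: "i \<in> {1..n} \<and> x \<in> switch \<beta> i \<longleftrightarrow> i = j" for i using j switch_unique by blast
  show ?thesis using True j(1) sw[of k] sw[of "Suc k"] by (auto simp: d1_switch[OF j(2,1)])
next
  case False
  then obtain j where j: "j \<le> n" "x \<in> equality \<beta> j" using equality_exists x by blast
  have eq: "k \<le> n \<and> x \<in> equality \<beta> k \<longleftrightarrow> k = j" using j equality_unique by blast
  have sw: "x \<notin> switch \<beta> i" if "1 \<le> i" "i \<le> n" for i
    using False that by (auto simp: switch_region_iff)
  have "d1 \<beta> (\<omega>, x) = k \<longleftrightarrow> k = j" using d1_equality[OF j(2,1) False] by auto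
  then show ?thesis using False eq sw[of k] sw[of "Suc k"] by auto
qed

lemma meas_d1 [measurable]: "d1 \<beta> \<in> phase_space \<beta> \<rightarrow>\<^sub>M count_space UNIV"
proof -
  have "d1 \<beta> -` {k} \<inter> space (phase_space \<beta>) \<in> sets (phase_space \<beta>)" for k
  proof -
    have "d1 \<beta> -` {k} \<inter> space (phase_space \<beta>) = {z \<in> space (phase_space \<beta>).
      (snd z \<notin> switch_region \<beta> \<and> k \<le> n \<and> snd z \<in> equality \<beta> k) \<or>
      (1 \<le> k \<and> k \<le> n \<and> snd z \<in> switch \<beta> k \<and> fst z 0) \<or>
      (Suc k \<le> n \<and> snd z \<in> switch \<beta> (Suc k) \<and> \<not> fst z 0)}"
    proof (intro set_eqI)
      fix z
      show "z \<in> d1 \<beta> -` {k} \<inter> space (phase_space \<beta>) \<longleftrightarrow> z \<in> {z \<in> space (phase_space \<beta>).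
        (snd z \<notin> switch_region \<beta> \<and> k \<le> n \<and> snd z \<in> equality \<beta> k) \<or>
        (1 \<le> k \<and> k \<le> n \<and> snd z \<in> switch \<beta> k \<and> fst z 0) \<or>
        (Suc k \<le> n \<and> snd z \<in> switch \<beta> (Suc k) \<and> \<not> fst z 0)}"
        using d1_eq_iff[of "snd z" "fst z" k] by (cases z) (simp add: space_phase, blast)
    qed
    then show ?thesis by simp
  qed
  then show ?thesis by (simp add: measurable_count_space_eq2_countable)
qed

lemma meas_K [measurable]: "K_beta \<beta> \<in> phase_space \<beta> \<rightarrow>\<^sub>M phase_space \<beta>"
proof -
  have "(\<lambda>z i. fst (K_beta \<beta> z) i) \<in> phase_space \<beta> \<rightarrow>\<^sub>M (\<Pi>\<^sub>M i\<in>UNIV. count_space UNIV)"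
  proof (rule measurable_PiM_single')
    fix i
    have "(\<lambda>z. fst (K_beta \<beta> z) i) = (\<lambda>z. if snd z \<in> switch_region \<beta> then fst z (Suc i) else fst z i)"
      by (rule ext) (simp add: K_beta_def shift_def case_prod_beta)
    then show "(\<lambda>z. fst (K_beta \<beta> z) i) \<in> phase_space \<beta> \<rightarrow>\<^sub>M count_space UNIV" by simp
  qed auto
  moreover have "(\<lambda>z. snd (K_beta \<beta> z)) \<in> phase_space \<beta> \<rightarrow>\<^sub>M restrict_space borel (J_beta \<beta>)"
    using K_beta_in_J by (intro measurable_restrict_space2) (auto simp: space_phase snd_K_beta)
  ultimately have "(\<lambda>z. (fst (K_beta \<beta> z), snd (K_beta \<beta> z))) \<in> phase_space \<beta> \<rightarrow>\<^sub>M
      (\<Pi>\<^sub>M i\<in>UNIV. count_space UNIV) \<Otimes>\<^sub>M restrict_space borel (J_beta \<beta>)"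
    by (rule measurable_Pair)
  then show ?thesis by (simp flip: phase_space_def)
qed

section \<open>Cylinders as partitions of the phase space\<close>

definition cyl :: "nat list \<Rightarrow> ((nat \<Rightarrow> bool) \<times> real) set" where
  "cyl w = {z \<in> space (phase_space \<beta>). starts \<beta> w z}"

lemma sets_cyl [measurable]: "cyl w \<in> sets (phase_space \<beta>)"
proof -
  have "Measurable.pred (phase_space \<beta>) (starts \<beta> w)"
  proof (induction w)
    case (Cons k w)
    note [measurable] = Cons
    show ?case by simp
  qed simp
  then show ?thesis unfolding cyl_def by measurable
qed

lemma funpow_K_in_space: "z \<in> space (phase_space \<beta>) \<Longrightarrow> (K_beta \<beta> ^^ m) z \<in> space (phase_space \<beta>)"
proof (induction m)
  case (Suc m)
  then show ?case using K_beta_in_J[of "(K_beta \<beta> ^^ m) z"] by (simp add: space_phase mem_Times_iff)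
qed simp

lemma cyl_split: "cyl w = (\<Union>k\<le>n. cyl (w @ [k]))"
proof -
  have "d1 \<beta> ((K_beta \<beta> ^^ length w) z) \<le> n" if "z \<in> space (phase_space \<beta>)" for z
    using d1_admissible[of "snd ((K_beta \<beta> ^^ length w) z)" "fst ((K_beta \<beta> ^^ length w) z)"]
      funpow_K_in_space[OF that, of "length w"] by (simp add: space_phase mem_Times_iff)
  then show ?thesis by (auto simp: cyl_def starts_append)
qed

lemma cyl_disjoint: "j \<noteq> k \<Longrightarrow> cyl (w @ [j]) \<inter> cyl (w @ [k]) = {}"
  by (auto simp: cyl_def starts_append)

lemma space_cover: "space (phase_space \<beta>) = (\<Union>w\<in>words n N. cyl w)"
proof (induction N)
  case (Suc N)
  have "(\<Union>w\<in>words n (Suc N). cyl w) \<subseteq> space (phase_space \<beta>)" by (auto simp: cyl_def)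
  moreover have "(\<Union>w\<in>words n N. cyl w) \<subseteq> (\<Union>w\<in>words n (Suc N). cyl w)"
  proof (intro UN_least)
    fix w assume w: "w \<in> words n N"
    have "w @ [k] \<in> words n (Suc N)" if "k \<le> n" for k using w that by (auto simp: words_def)
    then show "cyl w \<subseteq> (\<Union>w\<in>words n (Suc N). cyl w)" unfolding cyl_split[of w] by blast
  qed
  ultimately show ?case unfolding Suc.IH[symmetric] by (rule subset_antisym[rotated])
qed (simp add: cyl_def)

text \<open>The digit sequences of points of \<open>Z_beta \<beta> \<inter> cyl w\<close> begin with
  \<open>w\<close>, and the digits are independent and uniform on \<open>n + 1\<close>
  values.\<close>

lemma emeasure_nu_cyl:
  assumes "set w \<subseteq> {..n}"
  shows "emeasure (nu \<beta>) (cyl w) \<le> ennreal (1 / real (n + 1) ^ length w)"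
proof -
  interpret D: product_prob_space "\<lambda>_::nat. uniform_count_measure {0..n}" UNIV
    by (intro product_prob_spaceI prob_space_uniform_count_measure) auto
  let ?D = "digit_measure \<beta>"
  have D: "?D = (\<Pi>\<^sub>M i\<in>UNIV. uniform_count_measure {0..n})" by (simp add: digit_measure_def n_def)
  have "emeasure (nu \<beta>) (cyl w) = emeasure ?D (digits \<beta> ` (Z_beta \<beta> \<inter> cyl w))"
    by (rule emeasure_nu[OF gt1 nonint sets_cyl])
  also have "\<dots> \<le> emeasure ?D {d \<in> space ?D. \<forall>i\<in>{..<length w}. d i \<in> {w ! i}}"
  proof (rule emeasure_mono)
    show "digits \<beta> ` (Z_beta \<beta> \<inter> cyl w) \<subseteq> {d \<in> space ?D. \<forall>i\<in>{..<length w}. d i \<in> {w ! i}}"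
      using sets.sets_into_space[OF sets_digits_image[OF gt1 nonint sets_cyl, of w]]
      by (auto simp: cyl_def starts_iff_digits)
    show "{d \<in> space ?D. \<forall>i\<in>{..<length w}. d i \<in> {w ! i}} \<in> sets ?D"
      unfolding D using assms
      by (intro sets.sets_Collect_finite_All sets_Collect_single) (auto simp: sets_uniform_count_measure subset_eq)
  qed
  also have "\<dots> = (\<Prod>i\<in>{..<length w}. emeasure (uniform_count_measure {0..n}) {w ! i})"
    unfolding D using assms by (intro D.emeasure_PiM_Collect) (auto simp: sets_uniform_count_measure subset_eq)
  also have "\<dots> = (\<Prod>i\<in>{..<length w}. ennreal (1 / real (n + 1)))"
    using assms by (intro prod.cong refl) (auto simp: emeasure_uniform_count_measure subset_eq)
  also have "\<dots> = ennreal (1 / real (n + 1) ^ length w)"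
    by (simp add: ennreal_power power_one_over)
  finally show ?thesis .
qed

lemma emeasure_normalized_lebesgue:
  assumes "A \<in> sets borel" "A \<subseteq> J_beta \<beta>"
  shows "emeasure (normalized_lebesgue \<beta>) A = emeasure lborel A / emeasure lborel (J_beta \<beta>)"
proof -
  have J: "J_beta \<beta> \<in> sets lborel" by (simp add: J_beta_def)
  have A: "A \<in> sets (restrict_space lborel (J_beta \<beta>))"
    using assms J by (subst sets_restrict_space_iff) auto
  have J': "J_beta \<beta> \<in> sets (restrict_space lborel (J_beta \<beta>))"
    using J by (subst sets_restrict_space_iff) auto
  show ?thesis unfolding normalized_lebesgue_def
    using assms J by (subst emeasure_uniform_measure[OF J' A]) (simp add: emeasure_restrict_space Int_absorb1)
qed

end

section \<open>Cylinder masses under the product measure\<close>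

locale random_beta_coin = random_beta +
  fixes p :: real
begin

definition M :: "((nat \<Rightarrow> bool) \<times> real) measure" where
  "M = coin_measure p \<Otimes>\<^sub>M normalized_lebesgue \<beta>"

sublocale prob_space M
proof -
  interpret C: prob_space "coin_measure p" by (rule prob_space_coin_measure)
  interpret L: prob_space "normalized_lebesgue \<beta>" by (rule prob_space_normalized_lebesgue[OF gt1])
  interpret CL: pair_prob_space "coin_measure p" "normalized_lebesgue \<beta>" ..
  show "prob_space M" unfolding M_def by (rule CL.prob_space_axioms)
qed

lemma sets_M: "sets M = sets (phase_space \<beta>)"
  unfolding M_def by (rule sets_coin_lebesgue)

lemma space_M: "space M = space (phase_space \<beta>)"
  using sets_M by (rule sets_eq_imp_space_eq)

text \<open>Fubini with the coins on the outside: \<open>starts_contract\<close> compares sections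
  at a fixed coin sequence.\<close>

lemma emeasure_M_cyl:
  "emeasure M (cyl w) = (\<integral>\<^sup>+\<omega>. emeasure lborel {x \<in> J_beta \<beta>. starts \<beta> w (\<omega>, x)} / emeasure lborel (J_beta \<beta>) \<partial>coin_measure p)"
  "{x \<in> J_beta \<beta>. starts \<beta> w (\<omega>, x)} \<in> sets borel"
  "(\<lambda>\<omega>. emeasure lborel {x \<in> J_beta \<beta>. starts \<beta> w (\<omega>, x)} / emeasure lborel (J_beta \<beta>)) \<in> borel_measurable (coin_measure p)"
proof -
  interpret L: prob_space "normalized_lebesgue \<beta>" by (rule prob_space_normalized_lebesgue[OF gt1])
  have sec: "Pair \<omega> -` cyl w = {x \<in> J_beta \<beta>. starts \<beta> w (\<omega>, x)}" for \<omega>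
    by (auto simp: cyl_def space_phase)
  have cyl: "cyl w \<in> sets (coin_measure p \<Otimes>\<^sub>M normalized_lebesgue \<beta>)"
    using sets_cyl by (simp add: sets_coin_lebesgue)
  have J: "J_beta \<beta> \<in> sets lborel" by (simp add: J_beta_def)
  show S: "{x \<in> J_beta \<beta>. starts \<beta> w (\<omega>, x)} \<in> sets borel" for \<omega>
    using sets_Pair1[OF cyl, of \<omega>] J unfolding sec
    by (auto simp: normalized_lebesgue_def sets_restrict_space_iff)
  then have nl: "emeasure (normalized_lebesgue \<beta>) (Pair \<omega> -` cyl w) =
      emeasure lborel {x \<in> J_beta \<beta>. starts \<beta> w (\<omega>, x)} / emeasure lborel (J_beta \<beta>)" for \<omega>
    unfolding sec by (intro emeasure_normalized_lebesgue) auto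
  show "emeasure M (cyl w) = (\<integral>\<^sup>+\<omega>. emeasure lborel {x \<in> J_beta \<beta>. starts \<beta> w (\<omega>, x)} / emeasure lborel (J_beta \<beta>) \<partial>coin_measure p)"
    unfolding M_def L.emeasure_pair_measure_alt[OF cyl] nl ..
  show "(\<lambda>\<omega>. emeasure lborel {x \<in> J_beta \<beta>. starts \<beta> w (\<omega>, x)} / emeasure lborel (J_beta \<beta>)) \<in> borel_measurable (coin_measure p)"
    using L.measurable_emeasure_Pair[OF cyl] unfolding nl .
qed

text \<open>By \<open>starts_contract\<close> every coin section shrinks by the same factor
  \<open>1 / \<beta>\<close>, which therefore comes out of the integral.\<close>

lemma measure_M_contract:
  assumes u: "unsplit \<beta> bounds (U / \<beta> ^ m) u" "set u \<subseteq> {..n}" and m: "U < \<beta> ^ m"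
  shows "measure M (cyl (u @ replicate (Suc m) 0)) = measure M (cyl (u @ replicate m 0)) / \<beta>"
proof -
  have "emeasure lborel {x \<in> J_beta \<beta>. starts \<beta> (u @ replicate (Suc m) 0) (\<omega>, x)} =
    ennreal (1 / \<beta>) * emeasure lborel {x \<in> J_beta \<beta>. starts \<beta> (u @ replicate m 0) (\<omega>, x)}" for \<omega>
    using gt1 starts_contract[OF u m]
    by (intro emeasure_lborel_contract[where v = "word_val \<beta> u"] emeasure_M_cyl(2))
      (auto simp del: replicate_Suc)
  then have "emeasure M (cyl (u @ replicate (Suc m) 0)) = ennreal (1 / \<beta>) * emeasure M (cyl (u @ replicate m 0))"
    unfolding emeasure_M_cyl(1)
    by (simp add: ennreal_times_divide[symmetric] nn_integral_cmult emeasure_M_cyl(3) del: replicate_Suc)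
  then show ?thesis using gt1
    by (simp add: emeasure_eq_measure ennreal_mult[symmetric] del: replicate_Suc)
qed

lemma measure_M_split: "(\<Sum>k\<le>n. measure M (cyl (w @ [k]))) = measure M (cyl w)"
  unfolding cyl_split[of w]
  by (rule finite_measure_finite_Union[symmetric])
     (auto simp: sets_M disjoint_family_on_def dest: cyl_disjoint)

end

section \<open>Singularity\<close>

text \<open>Apply the hypothesis with \<open>(1/2) ^ k\<close> and take the limit superior
  \<open>S\<close> of the resulting sets. Borel-Cantelli makes \<open>S\<close> null for
  \<open>M\<close>. Its complement is a countable union of intersections, each null for
  \<open>N\<close> since it lies in sets of arbitrarily small \<open>N\<close>-mass.\<close>

lemma mutually_singularI:
  assumes sets: "sets M = sets N"
    and small: "\<And>\<epsilon>::real. \<epsilon> > 0 \<Longrightarrow> \<exists>A\<in>sets M. emeasure M A \<le> ennreal \<epsilon> \<and> emeasure N (space N - A) \<le> ennreal \<epsilon>"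
  shows "mutually_singular M N"
proof -
  have "\<exists>A\<in>sets M. emeasure M A \<le> ennreal ((1/2) ^ k) \<and> emeasure N (space N - A) \<le> ennreal ((1/2) ^ k)" for k :: nat
    by (rule small) simp
  then obtain A where A: "\<And>k. A k \<in> sets M" "\<And>k. emeasure M (A k) \<le> ennreal ((1/2) ^ k)"
      "\<And>k. emeasure N (space N - A k) \<le> ennreal ((1/2) ^ k)"
    by metis
  have AN: "A k \<in> sets N" for k using A(1) sets by simp
  have space: "space M = space N" using sets by (rule sets_eq_imp_space_eq)
  define S where "S = (\<Inter>i. \<Union>k\<in>{i..}. A k)"
  have S: "S \<in> sets M" unfolding S_def using A(1) by auto
  have half: "\<exists>i\<ge>j. (1/2::real) ^ i < e" if "e > 0" for e j
  proof -
    have "(\<lambda>i. (1/2::real) ^ i) \<longlonglongrightarrow> 0" by (intro LIMSEQ_power_zero) auto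
    then have "\<forall>\<^sub>F i in sequentially. (1/2::real) ^ i < e" using that by (rule order_tendstoD(2))
    then show ?thesis unfolding eventually_sequentially by (meson le_cases order_refl)
  qed
  have "AE x in M. \<forall>\<^sub>F k in sequentially. x \<in> space M - A k"
  proof (rule borel_cantelli_AE1[OF A(1)])
    show "emeasure M (A k) < \<infinity>" for k using A(2)[of k] by (auto simp: less_top[symmetric] top_unique)
    show "summable (\<lambda>k. measure M (A k))"
    proof (rule summable_comparison_test')
      show "summable (\<lambda>k. (1/2::real) ^ k)" by simp
      show "norm (measure M (A k)) \<le> (1/2) ^ k" for k
        using A(2)[of k] by (simp add: measure_def enn2real_leI)
    qed
  qed
  then have "AE x in M. x \<notin> S"
    by eventually_elim (force simp: S_def eventually_sequentially)
  then have "emeasure M S = 0"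
    using AE_iff_measurable[OF S, of "\<lambda>x. x \<notin> S"] sets.sets_into_space[OF S] by auto
  moreover have "emeasure N (space N - S) = 0"
  proof -
    have "emeasure N (\<Inter>k\<in>{i..}. space N - A k) = 0" for i
    proof (rule ccontr)
      let ?e = "emeasure N (\<Inter>k\<in>{i..}. space N - A k)"
      assume "?e \<noteq> 0"
      have le: "?e \<le> ennreal ((1/2) ^ k)" if "k \<ge> i" for k
        using that AN by (intro order_trans[OF emeasure_mono A(3)[of k]]) auto
      have "?e < \<top>" by (rule le_less_trans[OF le[OF order_refl] ennreal_less_top])
      then obtain r where r: "?e = ennreal r" "r \<ge> 0" by (cases ?e) auto
      then have "r > 0" using \<open>?e \<noteq> 0\<close> by (cases "r = 0") auto
      then obtain k where "k \<ge> i" "(1/2) ^ k < r" using half by blast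
      then show False using le[of k] r by (simp add: ennreal_le_iff)
    qed
    then have "emeasure N (\<Union>i. \<Inter>k\<in>{i..}. space N - A k) = 0"
      using AN by (intro emeasure_UN_eq_0) auto
    moreover have "space N - S = (\<Union>i. \<Inter>k\<in>{i..}. space N - A k)" by (auto simp: S_def)
    ultimately show ?thesis by simp
  qed
  ultimately show ?thesis using sets S unfolding mutually_singular_def by blast
qed

theorem theorem5:
  fixes \<beta> p :: real
  assumes "\<beta> > 1" and "\<beta> \<notin> \<int>" and "0 < p" and "p < 1"
  shows "mutually_singular (nu \<beta>) (coin_measure p \<Otimes>\<^sub>M normalized_lebesgue \<beta>)"
proof (rule mutually_singularI)
  interpret random_beta_coin \<beta> p by unfold_locales (use assms in auto)
  \<comment> \<open>The mass of the digit cylinder of \<open>u\<close> under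
    \<open>digit_measure \<beta>\<close>, which bounds its \<open>nu\<close>-mass by
    \<open>emeasure_nu_cyl\<close>.\<close>
  define w where "w u = 1 / real (n + 1) ^ length u" for u :: "nat list"
  define q where "q u = measure M (cyl u)" for u
  interpret W: cylinder_weights n w q
  proof
    show "q [] = 1" using prob_space by (simp add: q_def cyl_def space_M)
    show "(\<Sum>k\<le>n. q (u @ [k])) = q u" for u unfolding q_def by (rule measure_M_split)
  qed (simp_all add: w_def q_def)
  have good: "\<exists>m. \<forall>N. \<exists>G\<subseteq>words n N. (\<Sum>u\<in>words n N - G. w u) \<le> \<epsilon> \<and>
      (\<forall>u\<in>G. q (u @ replicate (Suc m) 0) = q (u @ replicate m 0) / \<beta>)" if \<epsilon>: "\<epsilon> > 0" for \<epsilon>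
  proof -
    \<comment> \<open>Two conditions hold for all large \<open>m\<close>:
      \<open>U < \<beta> ^ m\<close>, as \<open>measure_M_contract\<close> requires, and rarity of
      split words at every level \<open>N\<close>.\<close>
    obtain m0 where "U < \<beta> ^ m0" using real_arch_pow[OF gt1] by blast
    then have "\<forall>\<^sub>F m in sequentially. U < \<beta> ^ m"
      unfolding eventually_sequentially using gt1
      by (intro exI[of _ m0]) (auto intro: less_le_trans power_increasing)
    moreover have "\<forall>\<^sub>F m in sequentially. \<forall>N.
      real (card {u \<in> words n N. \<not> unsplit \<beta> bounds (U / \<beta> ^ m) u}) \<le> \<epsilon> * real (n + 1) ^ N"
      using few_split_words[OF gt1 n_bounds(1) finite_bounds \<epsilon>] by (simp add: U_def)
    ultimately have "\<forall>\<^sub>F m in sequentially. U < \<beta> ^ m \<and> (\<forall>N.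
      real (card {u \<in> words n N. \<not> unsplit \<beta> bounds (U / \<beta> ^ m) u}) \<le> \<epsilon> * real (n + 1) ^ N)"
      by eventually_elim simp
    then obtain m where m: "U < \<beta> ^ m" "\<And>N.
      real (card {u \<in> words n N. \<not> unsplit \<beta> bounds (U / \<beta> ^ m) u}) \<le> \<epsilon> * real (n + 1) ^ N"
      unfolding eventually_sequentially by blast
    show ?thesis
    proof (intro exI[of _ m] allI)
      fix N
      define G where "G = {u \<in> words n N. unsplit \<beta> bounds (U / \<beta> ^ m) u}"
      have "words n N - G = {u \<in> words n N. \<not> unsplit \<beta> bounds (U / \<beta> ^ m) u}"
        by (auto simp: G_def)
      moreover have "(\<Sum>u\<in>words n N - G. w u) = (\<Sum>u\<in>words n N - G. 1 / real (n + 1) ^ N)"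
        by (intro sum.cong refl) (auto simp: w_def length_words)
      ultimately have "(\<Sum>u\<in>words n N - G. w u) \<le> \<epsilon>"
        using m(2)[of N] by (simp add: divide_le_eq)
      moreover have "q (u @ replicate (Suc m) 0) = q (u @ replicate m 0) / \<beta>" if "u \<in> G" for u
        unfolding q_def using that by (intro measure_M_contract m) (auto simp: G_def words_def)
      ultimately show "\<exists>G\<subseteq>words n N. (\<Sum>u\<in>words n N - G. w u) \<le> \<epsilon> \<and>
          (\<forall>u\<in>G. q (u @ replicate (Suc m) 0) = q (u @ replicate m 0) / \<beta>)"
        by (intro exI[of _ G]) (auto simp: G_def)
    qed
  qed
  show "sets (nu \<beta>) = sets (coin_measure p \<Otimes>\<^sub>M normalized_lebesgue \<beta>)"
    by (simp add: sets_nu sets_coin_lebesgue)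
  fix \<epsilon> :: real assume "\<epsilon> > 0"
  then obtain N where N: "(\<Sum>u\<in>words n N. min (w u) (q u)) < \<epsilon>"
    using W.overlap_vanishes[of \<beta> \<epsilon>] good gt1 n_bounds by (auto simp: w_def)
  \<comment> \<open>\<open>V\<close> collects the words where \<open>w\<close> is the smaller
    weight, so the sums of \<open>w\<close> over \<open>V\<close> and of \<open>q\<close> off
    \<open>V\<close> add up to the overlap.\<close>
  define V where "V = {u \<in> words n N. w u \<le> q u}"
  define A where "A = (\<Union>u\<in>V. cyl u)"
  have V: "V \<subseteq> words n N" "finite V" "finite (words n N - V)"
    by (auto simp: V_def)
  have A: "A \<in> sets (nu \<beta>)" unfolding A_def sets_nu using V(2) by auto
  have sum_min: "(\<Sum>u\<in>V. w u) \<le> \<epsilon>" "(\<Sum>u\<in>words n N - V. q u) \<le> \<epsilon>"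
  proof -
    have "(\<Sum>u\<in>words n N. min (w u) (q u)) = (\<Sum>u\<in>words n N - V. min (w u) (q u)) + (\<Sum>u\<in>V. min (w u) (q u))"
      by (rule sum.subset_diff[OF V(1)]) simp
    moreover have "(\<Sum>u\<in>V. min (w u) (q u)) = (\<Sum>u\<in>V. w u)"
      by (intro sum.cong) (auto simp: V_def)
    moreover have "(\<Sum>u\<in>words n N - V. min (w u) (q u)) = (\<Sum>u\<in>words n N - V. q u)"
      by (intro sum.cong) (auto simp: V_def)
    moreover have "(\<Sum>u\<in>V. w u) \<ge> 0" "(\<Sum>u\<in>words n N - V. q u) \<ge> 0"
      by (auto intro!: sum_nonneg simp: w_def q_def)
    ultimately show "(\<Sum>u\<in>V. w u) \<le> \<epsilon>" "(\<Sum>u\<in>words n N - V. q u) \<le> \<epsilon>" using N by linarith+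
  qed
  have "emeasure (nu \<beta>) A \<le> (\<Sum>u\<in>V. emeasure (nu \<beta>) (cyl u))"
    unfolding A_def using V(2) by (intro emeasure_subadditive_finite) (auto simp: sets_nu)
  also have "\<dots> \<le> (\<Sum>u\<in>V. ennreal (w u))"
    unfolding w_def using V(1) by (intro sum_mono emeasure_nu_cyl) (auto simp: words_def)
  also have "\<dots> = ennreal (\<Sum>u\<in>V. w u)" by (rule sum_ennreal) (simp add: w_def)
  also have "\<dots> \<le> ennreal \<epsilon>" by (intro ennreal_leI sum_min)
  finally have nuA: "emeasure (nu \<beta>) A \<le> ennreal \<epsilon>" .
  have "space M - A \<subseteq> (\<Union>u\<in>words n N - V. cyl u)"
    unfolding space_M space_cover[of N] A_def by blast
  then have "emeasure M (space M - A) \<le> emeasure M (\<Union>u\<in>words n N - V. cyl u)"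
    using V(3) by (intro emeasure_mono) (auto simp: sets_M)
  also have "\<dots> \<le> (\<Sum>u\<in>words n N - V. emeasure M (cyl u))"
    using V(3) by (intro emeasure_subadditive_finite) (auto simp: sets_M)
  also have "\<dots> = ennreal (\<Sum>u\<in>words n N - V. q u)"
    unfolding q_def emeasure_eq_measure by (rule sum_ennreal) simp
  also have "\<dots> \<le> ennreal \<epsilon>" by (intro ennreal_leI sum_min)
  finally show "\<exists>A\<in>sets (nu \<beta>). emeasure (nu \<beta>) A \<le> ennreal \<epsilon> \<and>
      emeasure (coin_measure p \<Otimes>\<^sub>M normalized_lebesgue \<beta>)
        (space (coin_measure p \<Otimes>\<^sub>M normalized_lebesgue \<beta>) - A) \<le> ennreal \<epsilon>"
    using A nuA unfolding M_def by blast
qed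

end
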